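(* Let $G$ be a computable topological group with basis $(B_n)_{n\in\omega}$, and let $d$ be the metric on $G$ obtained by the following construction. Put $\mathcal{U}_0=G$ and $\mathcal{U}_{n+1}=\mathcal{U}_n\cap(B_nB_n^{-1})$. Put $\mathcal{V}_0=G$; given $\mathcal{V}_n$, let $f(x_0,y_0,x_1,y_1,x_2,y_2)=x_0y_0^{-1}x_1y_1^{-1}x_2y_2^{-1}$, effectively search for basic open sets $B_{i_0},\dots,B_{i_5}$ and $B$ with $B_{i_0}\times\dots\times B_{i_5}\subseteq f^{-1}(\mathcal{V}_n)$ and $B\subseteq \mathcal{V}_n\cap\bigcap_{j<6}B_{i_j}$, and for the first such found put $\mathcal{V}_{n+1}=(BB^{-1})\cap\mathcal{U}_{n+1}$. Let $\varrho(x,y)=\inf\{2^{-n}: x^{-1}y\in\mathcal{V}_n\}$ and $d(x,y)=\inf\{\sum_{i=0}^{l}\varrho(g_i,g_{i+1}) : l\in\omega,\ g_i\in G,\ g_0=x,\ g_{l+1}=y\}$. If $d$ is complete, then $G$ has a right-c.e. Polish presentation.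
   Context: All spaces and groups are Hausdorff and second countable. A computable topological space is a space $X$ together with an indexed countable base $(B_i)_{i\in\omega}$ of non-empty open sets and a c.e. set $W\subseteq\omega^3$ such that $B_i\cap B_j=\bigcup\{B_k : (i,j,k)\in W\}$ for all $i,j$. A name of an open set $U$ is any $S\subseteq\omega$ with $U=\bigcup_{i\in S}B_i$; $U$ is effectively open if it has a c.e. name. A map is effectively continuous if there is an enumeration operator which, given any enumeration of a name of an open set $V$ of the target, enumerates a name of $f^{-1}(V)$. A computable topological group is a group whose underlying space is a computable topological space such that multiplication and inversion are effectively continuous. (The sets $\mathcal{V}_n$ above are uniformly effectively open, and $d$ is a compatible left-invariant metric.) A right-c.e. Polish presentation of $G$ is a right-c.e. Polish group topologically isomorphic to $G$, where a right-c.e. Polish group is a Polish group with a compatible complete metric $d'$ and dense sequence $(x_i)$ such that $\{r\in\mathbb{Q}: d'(x_i,x_j)<r\}$ is uniformly c.e., and whose group operations are effectively continuous with respect to the computable topology generated by the balls $B_{d'}(x_i,r)$, $r\in\mathbb{Q}^+$. *)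

theory Defs
  imports
    "HOL-Analysis.Analysis"
    "HOL-Algebra.Coset"
    "HOL-Library.Nat_Bijection"
    "HOL-Library.Countable"
begin

section \<open>Computability\<close>

text \<open>
  \<open>partial_recursive n f\<close>: on argument lists of length \<open>n\<close>, \<open>f\<close> is a partial recursive
  (\<open>\<mu>\<close>-recursive) function, \<open>None\<close> standing for divergence. Values of \<open>f\<close> on lists of other
  lengths carry no meaning and are never used.
\<close>

inductive partial_recursive :: "nat \<Rightarrow> (nat list \<Rightarrow> nat option) \<Rightarrow> bool" where
  zero: "partial_recursive n (\<lambda>xs. Some 0)"
| succ: "partial_recursive 1 (\<lambda>xs. Some (Suc (hd xs)))"
| proj: "i < n \<Longrightarrow> partial_recursive n (\<lambda>xs. Some (xs ! i))"
| comp: "partial_recursive (length gs) f \<Longrightarrow> \<forall>g\<in>set gs. partial_recursive n g \<Longrightarrow>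
    partial_recursive n
      (\<lambda>xs. if \<exists>g\<in>set gs. g xs = None then None else f (map (\<lambda>g. the (g xs)) gs))"
| prim: "partial_recursive n f \<Longrightarrow> partial_recursive (Suc (Suc n)) g \<Longrightarrow>
    partial_recursive (Suc n)
      (\<lambda>xs. rec_nat (f (tl xs))
              (\<lambda>k r. case r of None \<Rightarrow> None | Some v \<Rightarrow> g (k # v # tl xs)) (hd xs))"
| mu: "partial_recursive (Suc n) f \<Longrightarrow>
    partial_recursive n
      (\<lambda>xs. if \<exists>z. f (z # xs) = Some 0 \<and> (\<forall>y<z. f (y # xs) \<noteq> None)
            then Some (LEAST z. f (z # xs) = Some 0) else None)"

definition ce :: "nat \<Rightarrow> nat list set \<Rightarrow> bool" where
  "ce n A \<longleftrightarrow> (\<exists>f. partial_recursive n f \<and> A = {xs. length xs = n \<and> f xs \<noteq> None})"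

definition computable2 :: "(nat \<Rightarrow> nat \<Rightarrow> nat) \<Rightarrow> bool" where
  "computable2 h \<longleftrightarrow> (\<exists>f. partial_recursive 2 f \<and> (\<forall>m n. f [m, n] = Some (h m n)))"

text \<open>
  The enumeration operator given by a set \<open>E\<close> of axioms \<open>(n, u)\<close>, to be read as: enumerate \<open>n\<close>
  once the finite set with canonical index \<open>u\<close> has been enumerated into the input.
\<close>

definition enum_op :: "(nat \<times> nat) set \<Rightarrow> nat set \<Rightarrow> nat set" where
  "enum_op E A = {n. \<exists>u. (n, u) \<in> E \<and> set_decode u \<subseteq> A}"

definition ce_axioms :: "(nat \<times> nat) set \<Rightarrow> bool" where
  "ce_axioms E \<longleftrightarrow> ce 2 {[n, u] |n u. (n, u) \<in> E}"


section \<open>Computable topological spaces and groups\<close>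

definition is_name :: "(nat \<Rightarrow> 'a set) \<Rightarrow> nat set \<Rightarrow> 'a set \<Rightarrow> bool" where
  "is_name B S U \<longleftrightarrow> U = (\<Union>i\<in>S. B i)"

text \<open>Second countability is implied by the presence of the countable base.\<close>

definition computable_topological_space :: "'a topology \<Rightarrow> (nat \<Rightarrow> 'a set) \<Rightarrow> bool" where
  "computable_topological_space X B \<longleftrightarrow>
     Hausdorff_space X \<and>
     (\<forall>i. B i \<noteq> {}) \<and>
     (\<forall>U. openin X U \<longleftrightarrow> (\<exists>S. is_name B S U)) \<and>
     (\<exists>W. ce 3 {[i, j, k] |i j k. (i, j, k) \<in> W} \<and>
          (\<forall>i j. B i \<inter> B j = \<Union>{B k |k. (i, j, k) \<in> W}))"

definition effectively_continuous ::
  "'a topology \<Rightarrow> (nat \<Rightarrow> 'a set) \<Rightarrow> 'b topology \<Rightarrow> (nat \<Rightarrow> 'b set) \<Rightarrow> ('a \<Rightarrow> 'b) \<Rightarrow> bool" where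
  "effectively_continuous X BX Y BY f \<longleftrightarrow>
     f \<in> topspace X \<rightarrow> topspace Y \<and>
     (\<exists>E. ce_axioms E \<and>
          (\<forall>V S. openin Y V \<and> is_name BY S V \<longrightarrow>
                 is_name BX (enum_op E S) {x \<in> topspace X. f x \<in> V}))"

definition prod_base :: "(nat \<Rightarrow> 'a set) \<Rightarrow> (nat \<Rightarrow> 'b set) \<Rightarrow> nat \<Rightarrow> ('a \<times> 'b) set" where
  "prod_base B C n = (case prod_decode n of (i, j) \<Rightarrow> B i \<times> C j)"

definition computable_topological_group ::
  "('a, 'm) monoid_scheme \<Rightarrow> 'a topology \<Rightarrow> (nat \<Rightarrow> 'a set) \<Rightarrow> bool" where
  "computable_topological_group G T B \<longleftrightarrow>
     group G \<and> topspace T = carrier G \<and>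
     computable_topological_space T B \<and>
     effectively_continuous (prod_topology T T) (prod_base B B) T B (\<lambda>(x, y). x \<otimes>\<^bsub>G\<^esub> y) \<and>
     effectively_continuous T B T B (\<lambda>x. inv\<^bsub>G\<^esub> x)"


section \<open>Right-c.e. Polish presentations\<close>

definition pos_rat :: "nat \<Rightarrow> real" where
  "pos_rat n = (case prod_decode n of (p, q) \<Rightarrow> real (Suc p) / real (Suc q))"

definition ball_base :: "'a set \<Rightarrow> ('a \<Rightarrow> 'a \<Rightarrow> real) \<Rightarrow> (nat \<Rightarrow> 'a) \<Rightarrow> nat \<Rightarrow> 'a set" where
  "ball_base M d x n = (case prod_decode n of (i, q) \<Rightarrow> Metric_space.mball M d (x i) (pos_rat q))"

text \<open>
  Being Polish is expressed by the compatible complete metric \<open>d\<close> and the dense sequence \<open>x\<close>;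
  continuity of the group operations is part of their effective continuity.
\<close>

definition right_ce_Polish_group ::
  "('a, 'm) monoid_scheme \<Rightarrow> 'a topology \<Rightarrow> ('a \<Rightarrow> 'a \<Rightarrow> real) \<Rightarrow> (nat \<Rightarrow> 'a) \<Rightarrow> bool" where
  "right_ce_Polish_group H T d x \<longleftrightarrow>
     Metric_space (carrier H) d \<and>
     Metric_space.mcomplete (carrier H) d \<and>
     T = Metric_space.mtopology (carrier H) d \<and>
     range x \<subseteq> carrier H \<and> T closure_of (range x) = carrier H \<and>
     ce 3 {[i, j, q] |i j q. d (x i) (x j) < of_rat (nat_to_rat_surj q)} \<and>
     computable_topological_group H T (ball_base (carrier H) d x)"

text \<open>
  The presentation may be taken on the underlying type of \<open>G\<close>: a group on any other type that is
  topologically isomorphic to \<open>G\<close> can be transported, with all its structure, along the isomorphism.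
\<close>

definition has_right_ce_Polish_presentation ::
  "('a, 'm) monoid_scheme \<Rightarrow> 'a topology \<Rightarrow> bool" where
  "has_right_ce_Polish_presentation G T \<longleftrightarrow>
     (\<exists>(H :: 'a monoid) T' d x \<phi>.
        right_ce_Polish_group H T' d x \<and> \<phi> \<in> iso G H \<and> homeomorphic_map T T' \<phi>)"


section \<open>The construction of the metric\<close>

primrec U_seq :: "('a, 'm) monoid_scheme \<Rightarrow> (nat \<Rightarrow> 'a set) \<Rightarrow> nat \<Rightarrow> 'a set" where
  "U_seq G B 0 = carrier G"
| "U_seq G B (Suc n) = U_seq G B n \<inter> (B n <#>\<^bsub>G\<^esub> set_inv\<^bsub>G\<^esub> (B n))"

text \<open>
  \<open>s n = [i\<^sub>0, \<dots>, i\<^sub>5, b]\<close> holds the indices found by the \<open>n\<close>-th search, \<open>b\<close> being that of the set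
  called \<open>B\<close> in the construction.
\<close>

primrec V_seq ::
  "('a, 'm) monoid_scheme \<Rightarrow> (nat \<Rightarrow> 'a set) \<Rightarrow> (nat \<Rightarrow> nat list) \<Rightarrow> nat \<Rightarrow> 'a set" where
  "V_seq G B s 0 = carrier G"
| "V_seq G B s (Suc n) =
     (B (last (s n)) <#>\<^bsub>G\<^esub> set_inv\<^bsub>G\<^esub> (B (last (s n)))) \<inter> U_seq G B (Suc n)"

definition six_fold :: "('a, 'm) monoid_scheme \<Rightarrow> 'a \<times> 'a \<times> 'a \<times> 'a \<times> 'a \<times> 'a \<Rightarrow> 'a" where
  "six_fold G = (\<lambda>(x0, y0, x1, y1, x2, y2).
     x0 \<otimes>\<^bsub>G\<^esub> inv\<^bsub>G\<^esub> y0 \<otimes>\<^bsub>G\<^esub> x1 \<otimes>\<^bsub>G\<^esub> inv\<^bsub>G\<^esub> y1 \<otimes>\<^bsub>G\<^esub> x2 \<otimes>\<^bsub>G\<^esub> inv\<^bsub>G\<^esub> y2)"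

definition search_hit ::
  "('a, 'm) monoid_scheme \<Rightarrow> (nat \<Rightarrow> 'a set) \<Rightarrow> 'a set \<Rightarrow> nat list \<Rightarrow> bool" where
  "search_hit G B V l \<longleftrightarrow>
     (\<exists>i0 i1 i2 i3 i4 i5 b. l = [i0, i1, i2, i3, i4, i5, b] \<and>
        B i0 \<times> B i1 \<times> B i2 \<times> B i3 \<times> B i4 \<times> B i5 \<subseteq> six_fold G -` V \<and>
        B b \<subseteq> V \<inter> (B i0 \<inter> B i1 \<inter> B i2 \<inter> B i3 \<inter> B i4 \<inter> B i5))"

text \<open>
  \<open>s\<close> is the sequence of outcomes of an effective search. The search is given by a computable
  function: \<open>h n k\<close> is what stage \<open>k\<close> of the search for the given \<open>\<V>\<^sub>n\<close> reports, namely a list of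
  indices for which the required inclusions hold, or \<open>[]\<close> for no report at this stage. The first
  report is taken. Inclusion of open sets is only verified through names, and which correct lists
  are reported, and in what order, depends on the names and operators used; so nothing beyond
  correctness and success is required of the search.
\<close>

definition effective_search ::
  "('a, 'm) monoid_scheme \<Rightarrow> (nat \<Rightarrow> 'a set) \<Rightarrow> (nat \<Rightarrow> nat list) \<Rightarrow> bool" where
  "effective_search G B s \<longleftrightarrow>
     (\<exists>h. computable2 (\<lambda>n k. list_encode (h n k)) \<and>
          (\<forall>n k. h n k \<noteq> [] \<longrightarrow> search_hit G B (V_seq G B s n) (h n k)) \<and>
          (\<forall>n. (\<exists>k. h n k \<noteq> []) \<and> s n = h n (LEAST k. h n k \<noteq> [])))"

definition rho :: "('a, 'm) monoid_scheme \<Rightarrow> (nat \<Rightarrow> 'a set) \<Rightarrow> 'a \<Rightarrow> 'a \<Rightarrow> real" where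
  "rho G V x y = Inf {(1/2) ^ n |n. inv\<^bsub>G\<^esub> x \<otimes>\<^bsub>G\<^esub> y \<in> V n}"

text \<open>
  The value \<open>0\<close> off the carrier is immaterial; it is there because \<^locale>\<open>Metric_space\<close> demands
  symmetry and nonnegativity on the whole type.
\<close>

definition chain_metric :: "('a, 'm) monoid_scheme \<Rightarrow> (nat \<Rightarrow> 'a set) \<Rightarrow> 'a \<Rightarrow> 'a \<Rightarrow> real" where
  "chain_metric G V x y =
     (if x \<in> carrier G \<and> y \<in> carrier G
      then Inf {\<Sum>i=0..l. rho G V (g i) (g (Suc i)) |l g.
                  (\<forall>i\<le>Suc l. g i \<in> carrier G) \<and> g 0 = x \<and> g (Suc l) = y}
      else 0)"

end

theory Submission
  imports Defs
begin

text \<open>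
  The metric \<open>d\<close> itself gives the presentation. By the Birkhoff--Kakutani argument \<open>d\<close> is a compatible
  left-invariant metric with \<open>d x y < 2\<^sup>-\<^sup>n \<Longrightarrow> x\<^sup>-\<^sup>1 y \<in> V\<^sub>n \<Longrightarrow> d x y \<le> 2\<^sup>-\<^sup>n\<close>, and \<open>d x y < r\<close> is an effectively
  open condition, because products of effectively open sets are effectively open.

  No points are given. Effectively choosing shrinking basic sets \<open>B\<^sub>j\<^sub>(\<^sub>l\<^sub>)\<close> with
  \<open>B\<^sub>j\<^sub>(\<^sub>l\<^sub>)\<^sup>-\<^sup>1 B\<^sub>j\<^sub>(\<^sub>l\<^sub>) \<subseteq> V\<^sub>l\<close>, one obtains points as limits, by completeness, and they are dense. That a
  limit \<open>x\<close> lies in \<open>B\<^sub>k\<close> is semidecidable although inclusions of open sets are not: it suffices that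
  some \<open>B\<^sub>j\<^sub>(\<^sub>l\<^sub>)\<close> meets some \<open>B\<^sub>a\<close> for which \<open>B\<^sub>a B\<^sub>m B\<^sub>m\<^sup>-\<^sup>1 \<subseteq> B\<^sub>k\<close> has been verified from the names, with
  \<open>l\<close> so large that points of \<open>B\<^sub>j\<^sub>(\<^sub>l\<^sub>)\<close> differ from \<open>x\<close> by an element of \<open>V\<^sub>m\<^sub>+\<^sub>1\<close>; the factor \<open>U\<^sub>m\<^sub>+\<^sub>1\<close> in the
  construction guarantees \<open>V\<^sub>m\<^sub>+\<^sub>1 \<subseteq> B\<^sub>m B\<^sub>m\<^sup>-\<^sup>1\<close>. Consequently the balls around these points and the
  given base are effectively interchangeable.
\<close>

section \<open>Computable functions and semidecidable predicates\<close>

subsection \<open>Total recursive functions\<close>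

text \<open>No point of \<open>G\<close> is given effectively, so the existence of a point with some
  property has to be certified by basic sets alone. These are non-empty, hence
  \<open>W i j k\<close> certifies that \<open>B i\<close> and \<open>B j\<close> meet, and the
  names of preimages under the group operations turn conditions on points into semidecidable
  relations between indices. \<open>NC\<close> and \<open>reach_step\<close> eliminate their points
  in this way.

  Since \<open>rho\<close> depends only on \<open>inv x \<otimes> y\<close>, a chain from
  \<open>x\<close> to \<open>y\<close> is a factorisation of \<open>inv x \<otimes> y\<close>. The
  infimum over chains of points thus becomes a union of countably many products of sets
  \<open>V n\<close>. The weights are dyadic, so comparing them with a rational is comparing natural
  numbers. The statements about \<open>d\<close> are phrased with strict inequalities:
  \<open>d x y < r\<close> is witnessed by a single product, whereas \<open>d x y \<le> r\<close>
  need not be.\<close>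

definition total_recursive :: "nat \<Rightarrow> (nat list \<Rightarrow> nat) \<Rightarrow> bool" where
  "total_recursive n f \<longleftrightarrow>
     (\<exists>g. partial_recursive n g \<and> (\<forall>xs. length xs = n \<longrightarrow> g xs = Some (f xs)))"

lemma total_recursive_cong:
  assumes "total_recursive n f" "\<And>xs. length xs = n \<Longrightarrow> f xs = g xs"
  shows "total_recursive n g"
  using assms unfolding total_recursive_def by metis

lemma total_recursive_zero: "total_recursive n (\<lambda>xs. 0)"
  unfolding total_recursive_def using partial_recursive.zero by blast

lemma total_recursive_proj: "i < n \<Longrightarrow> total_recursive n (\<lambda>xs. xs ! i)"
  unfolding total_recursive_def using partial_recursive.proj by blast

lemma partial_recursive_comp_total:
  assumes "partial_recursive (length gs) f" "\<And>g. g \<in> set gs \<Longrightarrow> total_recursive n g"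
  shows "\<exists>h. partial_recursive n h \<and> (\<forall>xs. length xs = n \<longrightarrow> h xs = f (map (\<lambda>g. g xs) gs))"
proof -
  obtain p where p: "\<And>g. g \<in> set gs \<Longrightarrow> partial_recursive n (p g)"
    "\<And>g xs. g \<in> set gs \<Longrightarrow> length xs = n \<Longrightarrow> p g xs = Some (g xs)"
    using assms(2) unfolding total_recursive_def by metis
  define h where "h = (\<lambda>xs. if \<exists>g\<in>set (map p gs). g xs = None then None
    else f (map (\<lambda>g. the (g xs)) (map p gs)))"
  have "partial_recursive n h"
    unfolding h_def by (rule partial_recursive.comp) (use assms(1) p(1) in auto)
  moreover have "h xs = f (map (\<lambda>g. g xs) gs)" if "length xs = n" for xs
  proof -
    have 1: "map (\<lambda>g. the (g xs)) (map p gs) = map (\<lambda>g. g xs) gs"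
      using p(2) that by auto
    have 2: "\<not> (\<exists>g\<in>set (map p gs). g xs = None)"
      using p(2) that by auto
    show ?thesis
      unfolding h_def 1 by (rule if_not_P[OF 2])
  qed
  ultimately show ?thesis by blast
qed

lemma total_recursive_comp:
  assumes "total_recursive (length gs) f" "\<And>g. g \<in> set gs \<Longrightarrow> total_recursive n g"
  shows "total_recursive n (\<lambda>xs. f (map (\<lambda>g. g xs) gs))"
proof -
  obtain p where p: "partial_recursive (length gs) p"
    "\<And>xs. length xs = length gs \<Longrightarrow> p xs = Some (f xs)"
    using assms(1) unfolding total_recursive_def by metis
  show ?thesis
    using partial_recursive_comp_total[OF p(1) assms(2)] p(2)
    unfolding total_recursive_def by (metis length_map)
qed

lemma total_recursive_comp1:
  assumes "total_recursive 1 f" "total_recursive n g"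
  shows "total_recursive n (\<lambda>xs. f [g xs])"
  using total_recursive_comp[of "[g]" f n] assms by simp

lemma total_recursive_Suc:
  assumes "total_recursive n f"
  shows "total_recursive n (\<lambda>xs. Suc (f xs))"
proof -
  have "total_recursive 1 (\<lambda>xs. Suc (hd xs))"
    unfolding total_recursive_def using partial_recursive.succ by blast
  from total_recursive_comp1[OF this assms] show ?thesis by simp
qed

lemma total_recursive_prim:
  assumes "total_recursive n f" "total_recursive (Suc (Suc n)) g"
  shows "total_recursive (Suc n) (\<lambda>xs. rec_nat (f (tl xs)) (\<lambda>k r. g (k # r # tl xs)) (hd xs))"
proof -
  obtain p where p: "partial_recursive n p" "\<And>xs. length xs = n \<Longrightarrow> p xs = Some (f xs)"
    using assms(1) unfolding total_recursive_def by metis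
  obtain q where q: "partial_recursive (Suc (Suc n)) q"
    "\<And>xs. length xs = Suc (Suc n) \<Longrightarrow> q xs = Some (g xs)"
    using assms(2) unfolding total_recursive_def by metis
  have *: "rec_nat (p ys) (\<lambda>k r. case r of None \<Rightarrow> None | Some v \<Rightarrow> q (k # v # ys)) m
      = Some (rec_nat (f ys) (\<lambda>k r. g (k # r # ys)) m)" if "length ys = n" for ys m
    by (induction m) (use p(2) q(2) that in auto)
  show ?thesis
    unfolding total_recursive_def
    by (intro exI conjI, rule partial_recursive.prim[OF p(1) q(1)]) (simp add: *)
qed

text \<open>The rule for primitive recursion recurses on the head of the argument list. Feeding it
  \<open>m xs # xs\<close> through projections frees the bound from that position and keeps all
  arguments available as parameters.\<close>

lemma total_recursive_rec:
  assumes "total_recursive n a" "total_recursive n m" "total_recursive (Suc (Suc n)) b"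
  shows "total_recursive n (\<lambda>xs. rec_nat (a xs) (\<lambda>k r. b (k # r # xs)) (m xs))"
proof -
  let ?gs = "m # map (\<lambda>i xs. xs ! i) [0..<n]"
  have *: "map (\<lambda>g. g xs) ?gs = m xs # xs" if "length xs = n" for xs
    using that map_nth[of xs] by (simp add: comp_def)
  have "total_recursive n (\<lambda>xs. (\<lambda>xs. rec_nat (a (tl xs)) (\<lambda>k r. b (k # r # tl xs)) (hd xs))
      (map (\<lambda>g. g xs) ?gs))"
    by (rule total_recursive_comp)
      (use total_recursive_prim[OF assms(1,3)] assms(2) total_recursive_proj in auto)
  then show ?thesis
    by (rule total_recursive_cong) (simp only: *, simp)
qed

lemma total_recursive_mu:
  assumes "total_recursive (Suc n) f" "\<And>xs. length xs = n \<Longrightarrow> \<exists>z. f (z # xs) = 0"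
  shows "total_recursive n (\<lambda>xs. LEAST z. f (z # xs) = 0)"
proof -
  obtain p where p: "partial_recursive (Suc n) p"
    "\<And>xs. length xs = Suc n \<Longrightarrow> p xs = Some (f xs)"
    using assms(1) unfolding total_recursive_def by metis
  have *: "(if \<exists>z. p (z # xs) = Some 0 \<and> (\<forall>y<z. p (y # xs) \<noteq> None)
      then Some (LEAST z. p (z # xs) = Some 0) else None) = Some (LEAST z. f (z # xs) = 0)"
    if "length xs = n" for xs
    using p(2) assms(2)[OF that] that by simp
  show ?thesis
    unfolding total_recursive_def
    by (intro exI conjI, rule partial_recursive.mu[OF p(1)]) (use * in auto)
qed

lemma total_recursive_add:
  assumes "total_recursive n f" "total_recursive n g"
  shows "total_recursive n (\<lambda>xs. f xs + g xs)"
proof -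
  have "total_recursive n (\<lambda>xs. rec_nat (g xs) (\<lambda>k r. (\<lambda>ys. Suc (ys ! 1)) (k # r # xs)) (f xs))"
    by (intro total_recursive_rec assms total_recursive_Suc total_recursive_proj) simp
  moreover have "rec_nat a (\<lambda>k r. Suc r) m = m + a" for a m :: nat
    by (induction m) auto
  ultimately show ?thesis by simp
qed

lemma total_recursive_diff:
  assumes "total_recursive n f" "total_recursive n g"
  shows "total_recursive n (\<lambda>xs. f xs - g xs)"
proof -
  have "total_recursive 1 (\<lambda>xs. rec_nat 0 (\<lambda>k r. (\<lambda>ys. ys ! 0) (k # r # xs)) (xs ! 0))"
    by (intro total_recursive_rec total_recursive_zero total_recursive_proj) auto
  moreover have "rec_nat 0 (\<lambda>k r. k) m = m - 1" for m :: nat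
    by (induction m) auto
  ultimately have pred: "total_recursive 1 (\<lambda>xs. xs ! 0 - 1)" by simp
  have "total_recursive n
      (\<lambda>xs. rec_nat (f xs) (\<lambda>k r. (\<lambda>ys. (\<lambda>zs. zs ! 0 - 1) [ys ! 1]) (k # r # xs)) (g xs))"
    by (intro total_recursive_rec assms total_recursive_comp1[OF pred] total_recursive_proj) simp
  moreover have "rec_nat a (\<lambda>k r. r - Suc 0) m = a - m" for a m :: nat
    by (induction m) auto
  ultimately show ?thesis by simp
qed

lemma total_recursive_triangle:
  assumes "total_recursive n f"
  shows "total_recursive n (\<lambda>xs. triangle (f xs))"
proof -
  have "total_recursive n (\<lambda>xs. rec_nat 0 (\<lambda>k r. (\<lambda>ys. ys ! 1 + Suc (ys ! 0)) (k # r # xs)) (f xs))"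
    by (intro total_recursive_rec assms total_recursive_zero total_recursive_add
        total_recursive_Suc total_recursive_proj) auto
  moreover have "rec_nat 0 (\<lambda>k r. r + Suc k) m = triangle m" for m :: nat
    by (induction m) auto
  ultimately show ?thesis by simp
qed

lemma total_recursive_prod_encode:
  assumes "total_recursive n f" "total_recursive n g"
  shows "total_recursive n (\<lambda>xs. prod_encode (f xs, g xs))"
  unfolding prod_encode_def split
  by (intro total_recursive_add total_recursive_triangle assms)

lemma triangle_mono: "m \<le> n \<Longrightarrow> triangle m \<le> triangle n"
  by (induction n) (auto simp: le_Suc_eq)

lemma prod_decode_triangle:
  "triangle (fst (prod_decode c) + snd (prod_decode c)) + fst (prod_decode c) = c"
proof -
  have "prod_encode (prod_decode c) = c" by simp
  then show ?thesis by (simp only: prod_encode_def split_def)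
qed

text \<open>The pairing function is \<open>triangle (a + b) + a\<close>, so the diagonal
  \<open>a + b\<close> is the least \<open>z\<close> with \<open>c < triangle (Suc z)\<close>.
  Decoding is therefore one minimisation followed by subtractions.\<close>

lemma prod_decode_diagonal:
  "(LEAST z. Suc c - triangle (Suc z) = 0) = fst (prod_decode c) + snd (prod_decode c)"
proof -
  define a b where "a = fst (prod_decode c)" and "b = snd (prod_decode c)"
  then have c: "c = triangle (a + b) + a"
    using prod_decode_triangle[of c] by simp
  have "(LEAST z. Suc c - triangle (Suc z) = 0) = a + b"
  proof (rule Least_equality)
    show "Suc c - triangle (Suc (a + b)) = 0"
      by (simp add: c)
  next
    fix z assume "Suc c - triangle (Suc z) = 0"
    then have "Suc (triangle (a + b) + a) \<le> triangle (Suc z)"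
      by (simp add: c)
    then have "\<not> Suc z \<le> a + b"
      using triangle_mono[of "Suc z" "a + b"] by linarith
    then show "a + b \<le> z" by simp
  qed
  then show ?thesis by (simp add: a_def b_def)
qed

lemma total_recursive_prod_decode:
  assumes "total_recursive n f"
  shows "total_recursive n (\<lambda>xs. fst (prod_decode (f xs)))"
    and "total_recursive n (\<lambda>xs. snd (prod_decode (f xs)))"
proof -
  have "total_recursive 1 (\<lambda>xs. LEAST z. (\<lambda>ys. Suc (ys ! 1) - triangle (Suc (ys ! 0))) (z # xs) = 0)"
  proof (rule total_recursive_mu)
    show "total_recursive (Suc 1) (\<lambda>ys. Suc (ys ! 1) - triangle (Suc (ys ! 0)))"
      by (intro total_recursive_diff total_recursive_Suc total_recursive_triangle
          total_recursive_proj) auto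
    fix xs :: "nat list"
    have "Suc (xs ! 0) - triangle (Suc (xs ! 0)) = 0" by simp
    then show "\<exists>z. Suc ((z # xs) ! 1) - triangle (Suc ((z # xs) ! 0)) = 0"
      by (metis One_nat_def nth_Cons_0 nth_Cons_Suc)
  qed
  then have "total_recursive 1 (\<lambda>xs. LEAST z. Suc (xs ! 0) - triangle (Suc z) = 0)"
    by simp
  then have diag: "total_recursive 1 (\<lambda>xs. fst (prod_decode (xs ! 0)) + snd (prod_decode (xs ! 0)))"
    by (simp only: prod_decode_diagonal)
  have c: "c - triangle (fst (prod_decode c) + snd (prod_decode c)) = fst (prod_decode c)" for c
    using prod_decode_triangle[of c] by linarith
  let ?s = "\<lambda>xs. (\<lambda>ys. fst (prod_decode (ys ! 0)) + snd (prod_decode (ys ! 0))) [f xs]"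
  have 1: "total_recursive n (\<lambda>xs. f xs - triangle (?s xs))"
    by (intro total_recursive_diff total_recursive_triangle total_recursive_comp1[OF diag] assms)
  also have "(\<lambda>xs. f xs - triangle (?s xs)) = (\<lambda>xs. fst (prod_decode (f xs)))"
    by (simp add: c)
  finally show fst: "total_recursive n (\<lambda>xs. fst (prod_decode (f xs)))" .
  have "total_recursive n (\<lambda>xs. ?s xs - fst (prod_decode (f xs)))"
    by (intro total_recursive_diff fst total_recursive_comp1[OF diag] assms)
  then show "total_recursive n (\<lambda>xs. snd (prod_decode (f xs)))"
    by simp
qed

subsection \<open>Computable functions between encoded types\<close>

text \<open>A bijection with the numbers makes every number a code, so recursive functions on codes
  correspond to functions on the type without a domain condition. With pairs as instances,
  computability of a compound term is proved by introduction rules that follow the term.\<close>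

class enc =
  fixes enc :: "'a \<Rightarrow> nat"
  assumes bij_enc: "bij enc"
begin

definition dec :: "nat \<Rightarrow> 'a" where
  "dec = the_inv enc"

lemma dec_enc [simp]: "dec (enc x) = x"
  using bij_enc by (simp add: dec_def bij_def the_inv_f_f)

lemma enc_dec [simp]: "enc (dec n) = n"
  using bij_enc by (simp add: dec_def bij_def f_the_inv_into_f)

end

instantiation nat :: enc
begin

definition "enc_nat = (id :: nat \<Rightarrow> nat)"

instance
  by standard (simp add: enc_nat_def)

end

instantiation prod :: (enc, enc) enc
begin

definition "enc_prod = (\<lambda>p :: 'a \<times> 'b. prod_encode (enc (fst p), enc (snd p)))"

instance
proof
  have "(enc :: 'a \<times> 'b \<Rightarrow> nat) = prod_encode \<circ> map_prod enc enc"
    by (rule ext) (auto simp: enc_prod_def)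
  moreover have "bij (map_prod (enc :: 'a \<Rightarrow> nat) (enc :: 'b \<Rightarrow> nat))"
    unfolding bij_def by (intro conjI prod.inj_map map_prod_surj bij_is_inj bij_is_surj bij_enc)
  ultimately show "bij (enc :: 'a \<times> 'b \<Rightarrow> nat)"
    by (metis bij_comp bij_prod_encode)
qed

end

lemma enc_nat [simp]: "enc (n :: nat) = n"
  by (simp add: enc_nat_def)

lemma enc_Pair [simp]: "enc (x, y) = prod_encode (enc x, enc y)"
  by (simp add: enc_prod_def)

lemma enc_fst: "enc (fst p) = fst (prod_decode (enc p))"
  and enc_snd: "enc (snd p) = snd (prod_decode (enc p))"
  by (cases p; simp)+

definition computable :: "('a::enc \<Rightarrow> 'b::enc) \<Rightarrow> bool" where
  "computable f \<longleftrightarrow> total_recursive 1 (\<lambda>xs. enc (f (dec (hd xs))))"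

lemma computableE:
  assumes "computable f" "total_recursive n (\<lambda>xs. enc (g xs))"
  shows "total_recursive n (\<lambda>xs. enc (f (g xs)))"
proof -
  have "total_recursive n (\<lambda>xs. (\<lambda>xs. enc (f (dec (hd xs)))) [enc (g xs)])"
    using assms unfolding computable_def by (intro total_recursive_comp1)
  then show ?thesis by simp
qed

lemma computableI:
  assumes "total_recursive 1 (\<lambda>xs. enc (f (dec (xs ! 0))))"
  shows "computable f"
  unfolding computable_def
  by (rule total_recursive_cong[OF assms]) (metis hd_conv_nth length_0_conv zero_neq_one)

lemma total_recursive_dec: "i < n \<Longrightarrow> total_recursive n (\<lambda>xs. enc (dec (xs ! i)))"
  by (simp add: total_recursive_proj)

lemma computable_comp:
  assumes "computable f" "computable g"
  shows "computable (\<lambda>x. f (g x))"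
  by (rule computableI) (intro computableE[OF assms(1)] computableE[OF assms(2)] total_recursive_dec, simp)

lemma computable_id: "computable (\<lambda>x. x)"
  by (rule computableI) (intro total_recursive_dec, simp)

lemma computable_const: "computable (\<lambda>x. c)"
proof -
  have "total_recursive 1 (\<lambda>xs. m)" for m
    by (induction m) (auto intro: total_recursive_zero total_recursive_Suc)
  then show ?thesis
    by (intro computableI)
qed

lemma computableD: "computable f \<Longrightarrow> total_recursive 1 (\<lambda>xs. enc (f (dec (xs ! 0))))"
  by (rule computableE[where g = "\<lambda>xs. dec (xs ! 0)"]) (auto intro: total_recursive_proj)

lemma computable_fst: "computable f \<Longrightarrow> computable (\<lambda>x. fst (f x))"
  by (rule computableI, unfold enc_fst) (intro total_recursive_prod_decode computableD)

lemma computable_snd: "computable f \<Longrightarrow> computable (\<lambda>x. snd (f x))"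
  by (rule computableI, unfold enc_snd) (intro total_recursive_prod_decode computableD)

lemma computable_Pair: "computable f \<Longrightarrow> computable g \<Longrightarrow> computable (\<lambda>x. (f x, g x))"
  by (rule computableI, unfold enc_Pair) (intro total_recursive_prod_encode computableD)

lemma computable_Suc: "computable f \<Longrightarrow> computable (\<lambda>x. Suc (f x))"
  using computableD[of f] by (intro computableI) (simp add: total_recursive_Suc)

lemma computable_add: "computable f \<Longrightarrow> computable g \<Longrightarrow> computable (\<lambda>x. f x + g x :: nat)"
  using computableD[of f] computableD[of g]
  by (intro computableI) (simp add: total_recursive_add)

lemma computable_diff: "computable f \<Longrightarrow> computable g \<Longrightarrow> computable (\<lambda>x. f x - g x :: nat)"
  using computableD[of f] computableD[of g]
  by (intro computableI) (simp add: total_recursive_diff)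

lemma computable_rec:
  fixes b :: "'a::enc \<Rightarrow> nat \<Rightarrow> 'b::enc \<Rightarrow> 'b"
  assumes a: "computable a" and m: "computable m"
    and b: "computable (\<lambda>p. b (fst p) (fst (snd p)) (snd (snd p)))"
  shows "computable (\<lambda>x. rec_nat (a x) (\<lambda>k r. b x k r) (m x))"
proof (rule computableI)
  let ?b = "\<lambda>ys. enc (b (dec (ys ! 2)) (ys ! 0) (dec (ys ! 1)))"
  have "total_recursive 3 (\<lambda>ys. enc ((\<lambda>p. b (fst p) (fst (snd p)) (snd (snd p)))
      (dec (ys ! 2), ys ! 0, dec (ys ! 1))))"
    by (rule computableE[OF b], unfold enc_Pair enc_dec enc_nat)
      (intro total_recursive_prod_encode total_recursive_proj, auto)
  then have "total_recursive (Suc (Suc 1)) ?b"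
    by (simp add: eval_nat_numeral)
  moreover have "total_recursive 1 (\<lambda>xs. enc (a (dec (xs ! 0))))"
    "total_recursive 1 (\<lambda>xs. enc (m (dec (xs ! 0))))"
    by (intro computableE[OF a] computableE[OF m] total_recursive_dec; simp)+
  ultimately have *: "total_recursive 1 (\<lambda>xs. rec_nat (enc (a (dec (xs ! 0)))) (\<lambda>k r. ?b (k # r # xs))
      (enc (m (dec (xs ! 0)))))"
    by (intro total_recursive_rec)
  have "rec_nat (enc (a x)) (\<lambda>k r. enc (b x k (dec r))) n = enc (rec_nat (a x) (b x) n)" for x n
    by (induction n) auto
  then show "total_recursive 1 (\<lambda>xs. enc (rec_nat (a (dec (xs ! 0))) (b (dec (xs ! 0))) (m (dec (xs ! 0)))))"
    using * by (simp add: eval_nat_numeral)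
qed

lemma computable_Least:
  fixes f :: "'a::enc \<Rightarrow> nat \<Rightarrow> nat"
  assumes f: "computable (\<lambda>p. f (fst p) (snd p))" and ex: "\<And>x. \<exists>z. f x z = 0"
  shows "computable (\<lambda>x. LEAST z. f x z = (0 :: nat))"
proof (rule computableI)
  have "total_recursive (Suc 1) (\<lambda>ys. enc ((\<lambda>p. f (fst p) (snd p)) (dec (ys ! 1), ys ! 0)))"
    by (rule computableE[OF f], unfold enc_Pair enc_dec enc_nat)
      (intro total_recursive_prod_encode total_recursive_proj, auto)
  then have *: "total_recursive (Suc 1) (\<lambda>ys. f (dec (ys ! 1)) (ys ! 0))" by simp
  show "total_recursive 1 (\<lambda>xs. enc (LEAST z. f (dec (xs ! 0)) z = 0))"
    using total_recursive_mu[OF *] ex by simp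
qed

lemma computable_comp2:
  "computable (\<lambda>p. f (fst p) (snd p)) \<Longrightarrow> computable g \<Longrightarrow> computable h \<Longrightarrow> computable (\<lambda>x. f (g x) (h x))"
  using computable_comp[of "\<lambda>p. f (fst p) (snd p)" "\<lambda>x. (g x, h x)"] by (simp add: computable_Pair)

lemma computable_dec: "computable f \<Longrightarrow> computable (\<lambda>x. dec (f x))"
  using computableD[of f] by (intro computableI) simp

lemma computable_enc: "computable f \<Longrightarrow> computable (\<lambda>x. enc (f x))"
  using computableD[of f] by (intro computableI) simp

lemma prod_decode_eq_dec: "prod_decode n = dec n"
  by (metis dec_enc enc_Pair enc_nat prod.collapse prod_decode_inverse)

lemma prod_encode_eq_enc: "prod_encode (m, n) = enc (m, n)"
  by simp

lemma computable_prod_decode: "computable f \<Longrightarrow> computable (\<lambda>x. prod_decode (f x))"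
  unfolding prod_decode_eq_dec by (rule computable_dec)

lemma computable_prod_encode:
  "computable f \<Longrightarrow> computable g \<Longrightarrow> computable (\<lambda>x. prod_encode (f x, g x))"
  unfolding prod_encode_eq_enc by (intro computable_enc computable_Pair)

lemmas computable_basic = computable_const computable_id computable_fst computable_snd
  computable_Pair computable_Suc computable_add computable_diff computable_dec computable_enc
  computable_prod_decode computable_prod_encode

lemma computable_mult:
  fixes f g :: "'a::enc \<Rightarrow> nat"
  assumes "computable f" "computable g"
  shows "computable (\<lambda>x. f x * g x)"
proof -
  have "computable (\<lambda>x. rec_nat 0 (\<lambda>k r. r + g x) (f x))"
    by (intro computable_rec computable_basic assms computable_comp[OF assms(2)])
  moreover have "rec_nat 0 (\<lambda>k r. r + b) a = a * b" for a b :: nat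
    by (induction a) auto
  ultimately show ?thesis by simp
qed

lemma computable_power2:
  fixes f :: "'a::enc \<Rightarrow> nat"
  assumes "computable f"
  shows "computable (\<lambda>x. 2 ^ f x :: nat)"
proof -
  have "computable (\<lambda>x. rec_nat 1 (\<lambda>k r. r + r :: nat) (f x))"
    by (intro computable_rec computable_basic assms)
  moreover have "rec_nat 1 (\<lambda>k r. r + r) a = (2 ^ a :: nat)" for a :: nat
    by (induction a) auto
  ultimately show ?thesis by simp
qed

text \<open>Halving is what \<open>int_decode\<close>, and with it the enumeration of the rationals,
  is computed with. The quotient is the least \<open>z\<close> with
  \<open>f x \<le> 2 * z + 1\<close>.\<close>

lemma computable_half:
  fixes f :: "'a::enc \<Rightarrow> nat"
  assumes "computable f"
  shows "computable (\<lambda>x. f x div 2)"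
proof -
  have "computable (\<lambda>x. LEAST z. f x - Suc (z + z) = 0)"
  proof (rule computable_Least)
    show "computable (\<lambda>p. f (fst p) - Suc (snd p + snd p))"
      by (intro computable_basic computable_comp[OF assms])
    show "\<exists>z. f x - Suc (z + z) = 0" for x
      by (rule exI[of _ "f x"]) simp
  qed
  moreover have "(LEAST z. a - Suc (z + z) = 0) = a div 2" for a :: nat
    by (rule Least_equality) auto
  ultimately show ?thesis by simp
qed

subsection \<open>Decidable predicates\<close>

definition decidable :: "('a::enc \<Rightarrow> bool) \<Rightarrow> bool" where
  "decidable P \<longleftrightarrow> computable (\<lambda>x. of_bool (P x) :: nat)"

lemma decidable_comp: "decidable P \<Longrightarrow> computable f \<Longrightarrow> decidable (\<lambda>x. P (f x))"
  unfolding decidable_def by (rule computable_comp)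

lemma decidable_comp2:
  "decidable (\<lambda>p. R (fst p) (snd p)) \<Longrightarrow> computable f \<Longrightarrow> computable g \<Longrightarrow> decidable (\<lambda>x. R (f x) (g x))"
  using decidable_comp[of "\<lambda>p. R (fst p) (snd p)" "\<lambda>x. (f x, g x)"] by (simp add: computable_Pair)

lemma decidable_not:
  assumes "decidable P"
  shows "decidable (\<lambda>x. \<not> P x)"
proof -
  have "computable (\<lambda>x. 1 - of_bool (P x) :: nat)"
    using assms unfolding decidable_def by (intro computable_basic)
  moreover have "(\<lambda>x. 1 - of_bool (P x) :: nat) = (\<lambda>x. of_bool (\<not> P x))" by auto
  ultimately show ?thesis by (simp only: decidable_def)
qed

lemma decidable_conj:
  assumes "decidable P" "decidable Q"
  shows "decidable (\<lambda>x. P x \<and> Q x)"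
proof -
  have "computable (\<lambda>x. of_bool (P x) + of_bool (Q x) - 1 :: nat)"
    using assms unfolding decidable_def by (intro computable_basic)
  moreover have "(\<lambda>x. of_bool (P x) + of_bool (Q x) - 1 :: nat) = (\<lambda>x. of_bool (P x \<and> Q x))" by auto
  ultimately show ?thesis by (simp only: decidable_def)
qed

lemma decidable_disj: "decidable P \<Longrightarrow> decidable Q \<Longrightarrow> decidable (\<lambda>x. P x \<or> Q x)"
  using decidable_not[OF decidable_conj[OF decidable_not[of P] decidable_not[of Q]]] by simp

lemma decidable_le:
  fixes f g :: "'a::enc \<Rightarrow> nat"
  assumes "computable f" "computable g"
  shows "decidable (\<lambda>x. f x \<le> g x)"
proof -
  have "computable (\<lambda>x. 1 - (f x - g x))"
    by (intro computable_basic assms)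
  moreover have "(\<lambda>x. 1 - (f x - g x)) = (\<lambda>x. of_bool (f x \<le> g x))" by auto
  ultimately show ?thesis by (simp only: decidable_def)
qed

lemma decidable_less:
  fixes f g :: "'a::enc \<Rightarrow> nat"
  shows "computable f \<Longrightarrow> computable g \<Longrightarrow> decidable (\<lambda>x. f x < g x)"
  unfolding Suc_le_eq[symmetric] by (intro decidable_le computable_Suc)

lemma decidable_eq:
  fixes f g :: "'a::enc \<Rightarrow> 'b::enc"
  assumes "computable f" "computable g"
  shows "decidable (\<lambda>x. f x = g x)"
proof -
  have "decidable (\<lambda>x. enc (f x) \<le> enc (g x) \<and> enc (g x) \<le> enc (f x))"
    by (intro decidable_conj decidable_le computable_enc assms)
  moreover have "(enc (f x) \<le> enc (g x) \<and> enc (g x) \<le> enc (f x)) = (f x = g x)" for x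
    by (metis dec_enc order_antisym order_refl)
  ultimately show ?thesis by simp
qed

text \<open>A primitive recursion counts the witnesses below the bound.\<close>

lemma decidable_bex:
  fixes n :: "'a::enc \<Rightarrow> nat"
  assumes P: "decidable (\<lambda>p. P (fst p) (snd p))" and n: "computable n"
  shows "decidable (\<lambda>x. \<exists>y<n x. P x y)"
proof -
  have "computable (\<lambda>p. of_bool (P (fst p) (fst (snd p))) :: nat)"
    using computable_comp[OF P[unfolded decidable_def], of "\<lambda>p. (fst p, fst (snd p))"]
    by (simp add: computable_basic)
  then have "computable (\<lambda>x. rec_nat (0 :: nat) (\<lambda>k r. r + of_bool (P x k)) (n x))"
    by (intro computable_rec computable_basic n)
  then have "decidable (\<lambda>x. \<not> rec_nat (0 :: nat) (\<lambda>k r. r + of_bool (P x k)) (n x) \<le> 0)"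
    by (intro decidable_not decidable_le computable_basic)
  moreover have "\<not> rec_nat (0 :: nat) (\<lambda>k r. r + of_bool (P x k)) m \<le> 0 \<longleftrightarrow> (\<exists>y<m. P x y)" for x m
    by (induction m) (auto simp: less_Suc_eq)
  ultimately show ?thesis by (simp only:)
qed

lemma decidable_ball:
  fixes n :: "'a::enc \<Rightarrow> nat"
  assumes P: "decidable (\<lambda>p. P (fst p) (snd p))" and n: "computable n"
  shows "decidable (\<lambda>x. \<forall>y<n x. P x y)"
  using decidable_not[OF decidable_bex[OF decidable_not[OF P] n]] by simp

lemma computable_Least_decidable:
  fixes R :: "'a::enc \<Rightarrow> nat \<Rightarrow> bool"
  assumes R: "decidable (\<lambda>p. R (fst p) (snd p))" and ex: "\<And>x. \<exists>z. R x z"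
  shows "computable (\<lambda>x. LEAST z. R x z)"
proof -
  have *: "computable (\<lambda>p. of_bool (\<not> R (fst p) (snd p)) :: nat)"
    using decidable_not[OF R] by (simp add: decidable_def)
  have "computable (\<lambda>x. LEAST z. of_bool (\<not> R x z) = (0 :: nat))"
    by (rule computable_Least[OF *]) (use ex in simp)
  then show ?thesis by simp
qed

subsection \<open>Semidecidable predicates\<close>

text \<open>One unbounded number quantifier over a decidable relation. In this form the closure
  properties are rearrangements of quantifiers, and computable choice is a search over
  \<open>k\<close>.\<close>

definition semidec :: "('a::enc \<Rightarrow> bool) \<Rightarrow> bool" where
  "semidec P \<longleftrightarrow>
     (\<exists>R. decidable (\<lambda>p. R (fst p) (snd p)) \<and> (\<forall>x. P x \<longleftrightarrow> (\<exists>k::nat. R x k)))"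

lemma semidecI:
  assumes "decidable (\<lambda>p. R (fst p) (snd p))" "\<And>x. P x \<longleftrightarrow> (\<exists>k::nat. R x k)"
  shows "semidec P"
  using assms unfolding semidec_def by blast

lemma semidecE:
  assumes "semidec P"
  obtains R where "decidable (\<lambda>p. R (fst p) (snd p))" "\<And>x. P x \<longleftrightarrow> (\<exists>k::nat. R x k)"
  using assms unfolding semidec_def by blast

lemma semidec_decidable: "decidable P \<Longrightarrow> semidec P"
  by (rule semidecI[of "\<lambda>x k. P x"]) (auto intro: decidable_comp[OF _ computable_fst[OF computable_id]])

lemmas semidec_eq = semidec_decidable[OF decidable_eq]
  and semidec_le = semidec_decidable[OF decidable_le]
  and semidec_less = semidec_decidable[OF decidable_less]

lemma semidec_True: "semidec (\<lambda>x. True)"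
  by (rule semidec_decidable) (simp add: decidable_def computable_const)

lemma semidec_comp:
  assumes "semidec P" "computable f"
  shows "semidec (\<lambda>x. P (f x))"
proof -
  obtain R where R: "decidable (\<lambda>p. R (fst p) (snd p))" "\<And>x. P x \<longleftrightarrow> (\<exists>k::nat. R x k)"
    using semidecE[OF assms(1)] by metis
  show ?thesis
    by (rule semidecI[of "\<lambda>x k. R (f x) k"])
      (use R(2) in \<open>auto intro!: decidable_comp2[OF R(1)] computable_basic computable_comp[OF assms(2)]\<close>)
qed

lemma semidec_comp2:
  assumes "semidec (\<lambda>p. R (fst p) (snd p))" "computable f" "computable g"
  shows "semidec (\<lambda>x. R (f x) (g x))"
proof -
  have "computable (\<lambda>x. (f x, g x))"
    by (intro computable_Pair assms)
  from semidec_comp[OF assms(1) this] show ?thesis by simp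
qed

lemma semidec_comp3:
  assumes "semidec (\<lambda>p. R (fst p) (fst (snd p)) (snd (snd p)))" "computable f" "computable g" "computable h"
  shows "semidec (\<lambda>x. R (f x) (g x) (h x))"
proof -
  have "computable (\<lambda>x. (f x, g x, h x))"
    by (intro computable_Pair assms)
  from semidec_comp[OF assms(1) this] show ?thesis by simp
qed

lemma semidec_comp4:
  assumes "semidec (\<lambda>p. R (fst p) (fst (snd p)) (fst (snd (snd p))) (snd (snd (snd p))))" "computable f" "computable g" "computable h" "computable k"
  shows "semidec (\<lambda>x. R (f x) (g x) (h x) (k x))"
proof -
  have "computable (\<lambda>x. (f x, g x, h x, k x))"
    by (intro computable_Pair assms)
  from semidec_comp[OF assms(1) this] show ?thesis by simp
qed

lemma semidec_conj:
  assumes "semidec P" "semidec Q"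
  shows "semidec (\<lambda>x. P x \<and> Q x)"
proof -
  obtain R where R: "decidable (\<lambda>p. R (fst p) (snd p))" "\<And>x. P x \<longleftrightarrow> (\<exists>k::nat. R x k)"
    using semidecE[OF assms(1)] by metis
  obtain S where S: "decidable (\<lambda>p. S (fst p) (snd p))" "\<And>x. Q x \<longleftrightarrow> (\<exists>k::nat. S x k)"
    using semidecE[OF assms(2)] by metis
  show ?thesis
  proof (rule semidecI)
    show "decidable (\<lambda>p. R (fst p) (fst (prod_decode (snd p))) \<and> S (fst p) (snd (prod_decode (snd p))))"
      by (intro decidable_conj decidable_comp2[OF R(1)] decidable_comp2[OF S(1)] computable_basic)
    show "(P x \<and> Q x) = (\<exists>k. R x (fst (prod_decode k)) \<and> S x (snd (prod_decode k)))" for x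
      unfolding R S by (metis fst_conv snd_conv prod_encode_inverse)
  qed
qed

lemma semidec_ex:
  fixes P :: "'a::enc \<Rightarrow> 'b::enc \<Rightarrow> bool"
  assumes "semidec (\<lambda>p. P (fst p) (snd p))"
  shows "semidec (\<lambda>x. \<exists>y. P x y)"
proof -
  obtain R where R: "decidable (\<lambda>p. R (fst p) (snd p))"
    "\<And>p. P (fst p) (snd p) \<longleftrightarrow> (\<exists>k::nat. R p k)"
    using semidecE[OF assms] by metis
  show ?thesis
  proof (rule semidecI)
    show "decidable (\<lambda>p. R (fst p, dec (fst (prod_decode (snd p)))) (snd (prod_decode (snd p))))"
      by (intro decidable_comp2[OF R(1)] computable_basic)
    show "(\<exists>y. P x y) = (\<exists>k. R (x, dec (fst (prod_decode k))) (snd (prod_decode k)))" for x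
      using R(2)[of "(x, _)"] by (metis dec_enc fst_conv snd_conv prod_encode_inverse)
  qed
qed

lemma semidec_disj:
  assumes "semidec P" "semidec Q"
  shows "semidec (\<lambda>x. P x \<or> Q x)"
proof -
  obtain R where R: "decidable (\<lambda>p. R (fst p) (snd p))" "\<And>x. P x \<longleftrightarrow> (\<exists>k::nat. R x k)"
    using semidecE[OF assms(1)] by metis
  obtain S where S: "decidable (\<lambda>p. S (fst p) (snd p))" "\<And>x. Q x \<longleftrightarrow> (\<exists>k::nat. S x k)"
    using semidecE[OF assms(2)] by metis
  show ?thesis
    by (rule semidecI[OF decidable_disj[OF R(1) S(1)]]) (use R(2) S(2) in auto)
qed

text \<open>Finitely many witnesses have a common bound \<open>K\<close>, so one number certifies
  all instances and the inner search becomes bounded, hence decidable.\<close>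

lemma semidec_ball:
  fixes n :: "'a::enc \<Rightarrow> nat"
  assumes P: "semidec (\<lambda>p. P (fst p) (snd p))" and n: "computable n"
  shows "semidec (\<lambda>x. \<forall>y<n x. P x y)"
proof -
  obtain R where R: "decidable (\<lambda>p. R (fst p) (snd p))"
    "\<And>p. P (fst p) (snd p) \<longleftrightarrow> (\<exists>k::nat. R p k)"
    using semidecE[OF P] by metis
  show ?thesis
  proof (rule semidecI)
    show "decidable (\<lambda>p. \<forall>y<n (fst p). \<exists>k<snd p. R (fst p, y) k)"
      by (intro decidable_ball decidable_bex decidable_comp2[OF R(1)] computable_basic
          computable_comp[OF n])
    have "(\<forall>y<m. \<exists>k. R (x, y) k) \<longleftrightarrow> (\<exists>K. \<forall>y<m. \<exists>k<K. R (x, y) k)" for x m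
    proof (induction m)
      case (Suc m)
      show ?case
      proof
        assume *: "\<forall>y<Suc m. \<exists>k. R (x, y) k"
        then obtain K k where "\<forall>y<m. \<exists>k<K. R (x, y) k" "R (x, m) k"
          using Suc by auto
        then have "\<forall>y<Suc m. \<exists>k'<K + Suc k. R (x, y) k'"
          by (metis less_Suc_eq trans_less_add1 trans_less_add2 lessI)
        then show "\<exists>K. \<forall>y<Suc m. \<exists>k<K. R (x, y) k" by blast
      qed blast
    qed simp
    then show "(\<forall>y<n x. P x y) = (\<exists>K. \<forall>y<n x. \<exists>k<K. R (x, y) k)" for x
      using R(2) by (metis fst_conv snd_conv)
  qed
qed

text \<open>Computable uniformisation: search for the least number coding a candidate
  \<open>y\<close> together with a stage that confirms it. A search over candidates alone could get
  stuck on one that is never confirmed.\<close>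

lemma semidec_select:
  fixes P :: "'a::enc \<Rightarrow> 'b::enc \<Rightarrow> bool"
  assumes P: "semidec (\<lambda>p. P (fst p) (snd p))" and ex: "\<And>x. \<exists>y. P x y"
  obtains f where "computable f" "\<And>x. P x (f x)"
proof -
  obtain R where R: "decidable (\<lambda>p. R (fst p) (snd p))"
    "\<And>p. P (fst p) (snd p) \<longleftrightarrow> (\<exists>k::nat. R p k)"
    using semidecE[OF P] by metis
  define Q where "Q x z = R (x, dec (fst (prod_decode z))) (snd (prod_decode z))" for x z
  have Q: "decidable (\<lambda>p. Q (fst p) (snd p))"
    unfolding Q_def by (intro decidable_comp2[OF R(1)] computable_basic)
  have exQ: "\<exists>z. Q x z" for x
  proof -
    obtain y where "P x y" using ex by blast
    then obtain k where "R (x, y) k" using R(2)[of "(x, y)"] by auto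
    then have "Q x (prod_encode (enc y, k))" by (simp add: Q_def)
    then show ?thesis by blast
  qed
  define f where "f x = (dec (fst (prod_decode (LEAST z. Q x z))) :: 'b)" for x
  have "computable f"
    unfolding f_def by (intro computable_basic computable_Least_decidable Q exQ)
  moreover have "P x (f x)" for x
    using LeastI_ex[OF exQ[of x]] R(2)[of "(x, f x)"] unfolding f_def Q_def by auto
  ultimately show ?thesis using that by blast
qed

section \<open>Finite sequences coded by numbers, and iterated relations\<close>

primrec elt :: "nat \<Rightarrow> nat \<Rightarrow> nat" where
  "elt 0 t = fst (prod_decode t)"
| "elt (Suc m) t = elt m (snd (prod_decode t))"

lemma computable_elt:
  assumes "computable f" "computable g"
  shows "computable (\<lambda>x. elt (f x) (g x))"
proof -
  have shift: "rec_nat (h t) (\<lambda>_ c. h c) m = h (rec_nat t (\<lambda>_ c. h c) m)" for h and t m :: nat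
    by (induction m) auto
  have "elt m t = fst (prod_decode (rec_nat t (\<lambda>_ c. snd (prod_decode c)) m))" for m t
    by (induction m arbitrary: t) (simp_all add: shift[of "\<lambda>c. snd (prod_decode c)"])
  moreover have "computable (\<lambda>x. fst (prod_decode (rec_nat (g x) (\<lambda>_ c. snd (prod_decode c)) (f x))))"
    by (intro computable_basic computable_rec assms)
  ultimately show ?thesis by simp
qed

lemma ex_elt: "\<exists>t. \<forall>m\<le>n. elt m t = f m"
proof (induction n arbitrary: f)
  case 0
  show ?case by (rule exI[of _ "prod_encode (f 0, 0)"]) simp
next
  case (Suc n)
  obtain t where t: "\<forall>m\<le>n. elt m t = f (Suc m)" using Suc[of "\<lambda>m. f (Suc m)"] ..
  have "elt m (prod_encode (f 0, t)) = f m" if "m \<le> Suc n" for m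
    using that t by (cases m) auto
  then show ?case by blast
qed

lemma iterate_relation_iff:
  "rec_nat Q (\<lambda>m Q s'. \<exists>s. Q s \<and> S m s s') n s' \<longleftrightarrow>
     (\<exists>f. Q (f 0) \<and> (\<forall>m<n. S m (f m) (f (Suc m))) \<and> f n = s')"
proof (induction n arbitrary: s')
  case 0
  then show ?case by auto
next
  case (Suc n)
  show ?case
  proof
    assume "rec_nat Q (\<lambda>m Q s'. \<exists>s. Q s \<and> S m s s') (Suc n) s'"
    then obtain s where "rec_nat Q (\<lambda>m Q s'. \<exists>s. Q s \<and> S m s s') n s" "S n s s'"
      by auto
    then obtain f where f: "Q (f 0)" "\<forall>m<n. S m (f m) (f (Suc m))" "S n (f n) s'"
      unfolding Suc.IH by (elim exE conjE) simp
    show "\<exists>f. Q (f 0) \<and> (\<forall>m<Suc n. S m (f m) (f (Suc m))) \<and> f (Suc n) = s'"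
      by (rule exI[of _ "f(Suc n := s')"]) (use f in \<open>auto simp: less_Suc_eq\<close>)
  next
    assume "\<exists>f. Q (f 0) \<and> (\<forall>m<Suc n. S m (f m) (f (Suc m))) \<and> f (Suc n) = s'"
    then obtain f where f: "Q (f 0)" "\<forall>m<Suc n. S m (f m) (f (Suc m))" "f (Suc n) = s'"
      by (elim exE conjE)
    have "rec_nat Q (\<lambda>m Q s'. \<exists>s. Q s \<and> S m s s') n (f n)"
      unfolding Suc.IH by (rule exI[of _ f]) (use f in simp)
    moreover have "S n (f n) s'"
      using f by auto
    ultimately show "rec_nat Q (\<lambda>m Q s'. \<exists>s. Q s \<and> S m s s') (Suc n) s'"
      by auto
  qed
qed

text \<open>Recursion on predicates is replaced by a quantifier over whole runs of states, and a run
  is coded by one number through \<open>elt\<close>. This serves primitive recursion with partial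
  values, the sets \<open>U_seq G B n\<close> and the products of sets \<open>V n\<close>.\<close>

lemma semidec_iterate:
  fixes Q :: "'a::enc \<Rightarrow> 's::enc \<Rightarrow> bool" and S :: "'a \<Rightarrow> nat \<Rightarrow> 's \<Rightarrow> 's \<Rightarrow> bool"
  assumes Q: "semidec (\<lambda>p. Q (fst p) (snd p))"
    and S: "semidec (\<lambda>p. S (fst p) (fst (snd p)) (fst (snd (snd p))) (snd (snd (snd p))))"
    and f: "computable f" and g: "computable g" and h: "computable h"
  shows "semidec (\<lambda>x. rec_nat (Q (f x)) (\<lambda>m Q s'. \<exists>s. Q s \<and> S (f x) m s s') (g x) (h x))"
proof -
  have "rec_nat (Q a) (\<lambda>m Q s'. \<exists>s. Q s \<and> S a m s s') n s' \<longleftrightarrow>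
      (\<exists>t. Q a (dec (elt 0 t)) \<and> (\<forall>m<n. S a m (dec (elt m t)) (dec (elt (Suc m) t))) \<and> dec (elt n t) = s')"
      (is "?L = ?R") for a n s'
  proof
    assume ?L
    then obtain f where f: "Q a (f 0)" "\<forall>m<n. S a m (f m) (f (Suc m))" "f n = s'"
      unfolding iterate_relation_iff by (elim exE conjE)
    obtain t where "\<forall>m\<le>n. elt m t = enc (f m)" using ex_elt[of n "\<lambda>m. enc (f m)"] ..
    then have "\<forall>m\<le>n. dec (elt m t) = f m" by simp
    then show ?R using f by (intro exI[of _ t]) (simp del: elt.simps)
  next
    assume ?R
    then obtain t where "Q a (dec (elt 0 t))" "\<forall>m<n. S a m (dec (elt m t)) (dec (elt (Suc m) t))"
      "dec (elt n t) = s'" by blast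
    then show ?L
      unfolding iterate_relation_iff by (intro exI[of _ "\<lambda>m. dec (elt m t)"] conjI)
  qed
  moreover have "semidec (\<lambda>x. \<exists>t. Q (f x) (dec (elt 0 t)) \<and>
      (\<forall>m<g x. S (f x) m (dec (elt m t)) (dec (elt (Suc m) t))) \<and> dec (elt (g x) t) = h x)"
    by (intro semidec_ex semidec_conj semidec_ball semidec_comp2[OF Q] semidec_comp4[OF S]
        semidec_eq computable_basic computable_elt computable_comp[OF f] computable_comp[OF g]
        computable_comp[OF h])
  ultimately show ?thesis by simp
qed

lemmas semidec_basic = semidec_ex semidec_conj semidec_disj semidec_ball semidec_eq semidec_le
  semidec_less computable_basic computable_mult computable_power2 computable_half computable_elt

subsection \<open>Computably enumerable sets\<close>

text \<open>Nested exactly as \<open>elt\<close> reads it: prefixing an argument is one pairing, and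
  a single unary predicate serves argument lists of every length.\<close>

primrec tuple :: "nat list \<Rightarrow> nat" where
  "tuple [] = 0"
| "tuple (x # xs) = prod_encode (x, tuple xs)"

definition graph_semidec :: "nat \<Rightarrow> (nat list \<Rightarrow> nat option) \<Rightarrow> bool" where
  "graph_semidec n f \<longleftrightarrow> (\<exists>R. semidec (\<lambda>p. R (fst p) (snd p)) \<and>
     (\<forall>xs v. length xs = n \<longrightarrow> (f xs = Some v \<longleftrightarrow> R (tuple xs) v)))"

lemma graph_semidecI:
  assumes "semidec (\<lambda>p. R (fst p) (snd p))"
    "\<And>xs v. length xs = n \<Longrightarrow> f xs = Some v \<longleftrightarrow> R (tuple xs) v"
  shows "graph_semidec n f"
  using assms unfolding graph_semidec_def by (intro exI[of _ R]) auto

lemma graph_semidecE: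
  assumes "graph_semidec n f"
  obtains R where "semidec (\<lambda>p. R (fst p) (snd p))"
    "\<And>xs v. length xs = n \<Longrightarrow> f xs = Some v \<longleftrightarrow> R (tuple xs) v"
  using assms unfolding graph_semidec_def by (elim exE conjE) simp

lemma fst_prod_decode_tuple: "xs \<noteq> [] \<Longrightarrow> fst (prod_decode (tuple xs)) = hd xs"
  and snd_prod_decode_tuple: "xs \<noteq> [] \<Longrightarrow> snd (prod_decode (tuple xs)) = tuple (tl xs)"
  by (cases xs; simp)+

lemma elt_tuple: "i < length xs \<Longrightarrow> elt i (tuple xs) = xs ! i"
  by (induction xs arbitrary: i) (auto simp: less_Suc_eq_0_disj)

lemma graph_semidec_tuple:
  assumes "\<And>g. g \<in> set gs \<Longrightarrow> graph_semidec n g"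
  shows "\<exists>R. semidec (\<lambda>p. R (fst p) (snd p)) \<and> (\<forall>xs c. length xs = n \<longrightarrow>
    (R (tuple xs) c \<longleftrightarrow> (\<forall>g\<in>set gs. g xs \<noteq> None) \<and> c = tuple (map (\<lambda>g. the (g xs)) gs)))"
  using assms
proof (induction gs)
  case Nil
  have "semidec (\<lambda>p :: nat \<times> nat. snd p = 0)"
    by (intro semidec_basic)
  then show ?case by (intro exI[of _ "\<lambda>a c. c = 0"]) simp
next
  case (Cons g gs)
  obtain R where R: "semidec (\<lambda>p. R (fst p) (snd p))"
    "\<And>xs c. length xs = n \<Longrightarrow>
      R (tuple xs) c \<longleftrightarrow> (\<forall>g\<in>set gs. g xs \<noteq> None) \<and> c = tuple (map (\<lambda>g. the (g xs)) gs)"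
    using Cons by auto
  obtain S where S: "semidec (\<lambda>p. S (fst p) (snd p))"
    "\<And>xs v. length xs = n \<Longrightarrow> g xs = Some v \<longleftrightarrow> S (tuple xs) v"
    using graph_semidecE[of n g] Cons.prems by auto
  let ?R = "\<lambda>a c. S a (fst (prod_decode c)) \<and> R a (snd (prod_decode c))"
  have "semidec (\<lambda>p. ?R (fst p) (snd p))"
    by (intro semidec_basic semidec_comp2[OF R(1)] semidec_comp2[OF S(1)])
  moreover have "?R (tuple xs) c \<longleftrightarrow>
      (\<forall>g\<in>set (g # gs). g xs \<noteq> None) \<and> c = tuple (map (\<lambda>g. the (g xs)) (g # gs))"
    if "length xs = n" for xs c
  proof -
    obtain a b where c: "c = prod_encode (a, b)" by (metis prod_decode_inverse prod.collapse)
    show ?thesis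
      using R(2)[OF that, of b] S(2)[OF that, of a, symmetric] by (auto simp: c)
  qed
  ultimately show ?case by (intro exI[of _ ?R]) simp
qed

lemma graph_semidec_comp:
  assumes f: "graph_semidec (length gs) f" and gs: "\<And>g. g \<in> set gs \<Longrightarrow> graph_semidec n g"
  shows "graph_semidec n
      (\<lambda>xs. if \<exists>g\<in>set gs. g xs = None then None else f (map (\<lambda>g. the (g xs)) gs))"
proof -
  obtain R where R: "semidec (\<lambda>p. R (fst p) (snd p))"
    "\<And>xs c. length xs = n \<Longrightarrow>
      R (tuple xs) c \<longleftrightarrow> (\<forall>g\<in>set gs. g xs \<noteq> None) \<and> c = tuple (map (\<lambda>g. the (g xs)) gs)"
    using graph_semidec_tuple[of gs n] gs by auto
  obtain S where S: "semidec (\<lambda>p. S (fst p) (snd p))"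
    "\<And>xs v. length xs = length gs \<Longrightarrow> f xs = Some v \<longleftrightarrow> S (tuple xs) v"
    using graph_semidecE[OF f] by metis
  show ?thesis
  proof (rule graph_semidecI)
    show "semidec (\<lambda>p. \<exists>c. R (fst p) c \<and> S c (snd p))"
      by (intro semidec_basic semidec_comp2[OF R(1)] semidec_comp2[OF S(1)])
    show "((if \<exists>g\<in>set gs. g xs = None then None else f (map (\<lambda>g. the (g xs)) gs)) = Some v)
        = (\<exists>c. R (tuple xs) c \<and> S c v)" if "length xs = n" for xs v
      using R(2)[OF that] S(2)[of "map (\<lambda>g. the (g xs)) gs" v] by auto
  qed
qed

text \<open>A value of the recursion at \<open>m\<close> is the end of a run of intermediate values.
  If one of these diverges there is simply no run, so divergence needs no treatment of its
  own.\<close>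

lemma graph_semidec_prim:
  assumes f: "graph_semidec n f" and g: "graph_semidec (Suc (Suc n)) g"
  shows "graph_semidec (Suc n)
      (\<lambda>xs. rec_nat (f (tl xs))
              (\<lambda>k r. case r of None \<Rightarrow> None | Some v \<Rightarrow> g (k # v # tl xs)) (hd xs))"
proof -
  obtain R where R: "semidec (\<lambda>p. R (fst p) (snd p))"
    "\<And>xs v. length xs = n \<Longrightarrow> f xs = Some v \<longleftrightarrow> R (tuple xs) v"
    using graph_semidecE[OF f] by metis
  obtain S where S: "semidec (\<lambda>p. S (fst p) (snd p))"
    "\<And>xs v. length xs = Suc (Suc n) \<Longrightarrow> g xs = Some v \<longleftrightarrow> S (tuple xs) v"
    using graph_semidecE[OF g] by metis
  define H where "H c m v = rec_nat (R c) (\<lambda>m Q s'. \<exists>s. Q s \<and>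
    S (prod_encode (m, prod_encode (s, c))) s') m v" for c m v
  have "rec_nat (f ys) (\<lambda>k r. case r of None \<Rightarrow> None | Some v \<Rightarrow> g (k # v # ys)) m = Some v
      \<longleftrightarrow> H (tuple ys) m v" if "length ys = n" for ys m v
  proof (induction m arbitrary: v)
    case 0
    show ?case using R(2)[OF that] by (simp add: H_def)
  next
    case (Suc m)
    let ?f = "rec_nat (f ys) (\<lambda>k r. case r of None \<Rightarrow> None | Some v \<Rightarrow> g (k # v # ys))"
    have "g (m # s # ys) = Some v \<longleftrightarrow> S (prod_encode (m, prod_encode (s, tuple ys))) v" for s
      using S(2)[of "m # s # ys"] that by simp
    moreover have "?f (Suc m) = Some v \<longleftrightarrow> (\<exists>s. ?f m = Some s \<and> g (m # s # ys) = Some v)"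
      by (auto split: option.splits)
    moreover have "H (tuple ys) (Suc m) v \<longleftrightarrow>
        (\<exists>s. H (tuple ys) m s \<and> S (prod_encode (m, prod_encode (s, tuple ys))) v)"
      by (simp add: H_def)
    ultimately show ?case
      using Suc by simp
  qed
  moreover have "semidec (\<lambda>p. H (snd (prod_decode (fst p))) (fst (prod_decode (fst p))) (snd p))"
    unfolding H_def
    by (rule semidec_iterate[where Q = R and S = "\<lambda>c m s s'. S (prod_encode (m, prod_encode (s, c))) s'"])
      (intro semidec_basic semidec_comp2[OF R(1)] semidec_comp2[OF S(1)])+
  ultimately show ?thesis
    by (intro graph_semidecI[where R = "\<lambda>c v. H (snd (prod_decode c)) (fst (prod_decode c)) v"])
      (auto simp: fst_prod_decode_tuple snd_prod_decode_tuple simp flip: length_greater_0_conv)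
qed

lemma graph_semidec_mu:
  assumes f: "graph_semidec (Suc n) f"
  shows "graph_semidec n
      (\<lambda>xs. if \<exists>z. f (z # xs) = Some 0 \<and> (\<forall>y<z. f (y # xs) \<noteq> None)
            then Some (LEAST z. f (z # xs) = Some 0) else None)"
proof -
  obtain R where R: "semidec (\<lambda>p. R (fst p) (snd p))"
    "\<And>xs v. length xs = Suc n \<Longrightarrow> f xs = Some v \<longleftrightarrow> R (tuple xs) v"
    using graph_semidecE[OF f] by metis
  \<comment> \<open>A positive value \<open>Suc w\<close> at each \<open>y < v\<close> expresses
    convergence and minimality at once, without a negation.\<close>
  let ?R = "\<lambda>c v. R (prod_encode (v, c)) 0 \<and> (\<forall>y<v. \<exists>w. R (prod_encode (y, c)) (Suc w))"
  have "semidec (\<lambda>p. ?R (fst p) (snd p))"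
    by (intro semidec_basic semidec_comp2[OF R(1)])
  moreover have "(if \<exists>z. f (z # xs) = Some 0 \<and> (\<forall>y<z. f (y # xs) \<noteq> None)
      then Some (LEAST z. f (z # xs) = Some 0) else None) = Some v \<longleftrightarrow> ?R (tuple xs) v"
    if "length xs = n" for xs v
  proof -
    have f_iff: "f (z # xs) = Some w \<longleftrightarrow> R (prod_encode (z, tuple xs)) w" for z w
      using R(2)[of "z # xs"] that by simp
    have "?R (tuple xs) v \<longleftrightarrow> f (v # xs) = Some 0 \<and> (\<forall>y<v. \<exists>w. f (y # xs) = Some (Suc w))"
      by (simp add: f_iff)
    also have "\<dots> \<longleftrightarrow> (\<exists>z. f (z # xs) = Some 0 \<and> (\<forall>y<z. f (y # xs) \<noteq> None))
        \<and> (LEAST z. f (z # xs) = Some 0) = v" (is "?L \<longleftrightarrow> ?r")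
    proof
      assume L: ?L
      have "(LEAST z. f (z # xs) = Some 0) = v"
      proof (rule Least_equality)
        fix y assume "f (y # xs) = Some 0"
        then have "\<not> y < v" using L by force
        then show "v \<le> y" by simp
      qed (use L in simp)
      moreover have "\<forall>y<v. f (y # xs) \<noteq> None" using L by force
      ultimately show ?r using L by blast
    next
      assume ?r
      then obtain z where z: "f (z # xs) = Some 0" "\<forall>y<z. f (y # xs) \<noteq> None"
        and v: "v = (LEAST z. f (z # xs) = Some 0)" by blast
      have "f (v # xs) = Some 0" unfolding v by (rule LeastI[of _ z]) (rule z)
      moreover have "v \<le> z" unfolding v by (rule Least_le) (rule z)
      have nz: "f (y # xs) \<noteq> Some 0" if "y < v" for y
        using that not_less_Least unfolding v by blast
      moreover have "\<exists>w. f (y # xs) = Some (Suc w)" if "y < v" for y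
      proof -
        have "f (y # xs) \<noteq> None" using z(2) that \<open>v \<le> z\<close> by simp
        then obtain w where "f (y # xs) = Some w" by blast
        with nz[OF that] show ?thesis by (cases w) auto
      qed
      ultimately show ?L by blast
    qed
    finally show ?thesis by auto
  qed
  ultimately show ?thesis by (intro graph_semidecI)
qed

text \<open>Working with graphs up to semidecidability makes a universal function or a step counter
  unnecessary: every closure rule of the recursive functions is one of semidecidable relations.\<close>

lemma partial_recursive_graph_semidec: "partial_recursive n f \<Longrightarrow> graph_semidec n f"
proof (induction rule: partial_recursive.induct)
  case (zero n)
  have "semidec (\<lambda>p :: nat \<times> nat. snd p = 0)"
    by (intro semidec_basic)
  then show ?case by (intro graph_semidecI[where R = "\<lambda>c v. v = 0"]) auto
next
  case succ
  have "semidec (\<lambda>p :: nat \<times> nat. snd p = Suc (fst (prod_decode (fst p))))"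
    by (intro semidec_basic)
  then show ?case
    by (intro graph_semidecI[where R = "\<lambda>c v. v = Suc (fst (prod_decode c))"])
      (auto simp: length_Suc_conv)
next
  case (proj i n)
  have "semidec (\<lambda>p :: nat \<times> nat. snd p = elt i (fst p))"
    by (intro semidec_basic)
  then show ?case
    by (intro graph_semidecI[where R = "\<lambda>c v. v = elt i c"]) (use proj in \<open>auto simp: elt_tuple\<close>)
next
  case (comp gs f n)
  then show ?case by (intro graph_semidec_comp) auto
next
  case (prim n f g)
  then show ?case by (intro graph_semidec_prim)
next
  case (mu n f)
  then show ?case by (intro graph_semidec_mu)
qed

lemma ce_imp_semidec:
  assumes "ce n A"
  shows "\<exists>R. semidec R \<and> (\<forall>xs. length xs = n \<longrightarrow> (xs \<in> A \<longleftrightarrow> R (tuple xs)))"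
proof -
  obtain f where f: "partial_recursive n f" "A = {xs. length xs = n \<and> f xs \<noteq> None}"
    using assms unfolding ce_def by blast
  obtain R where R: "semidec (\<lambda>p. R (fst p) (snd p))"
    "\<And>xs v. length xs = n \<Longrightarrow> f xs = Some v \<longleftrightarrow> R (tuple xs) v"
    using graph_semidecE[OF partial_recursive_graph_semidec[OF f(1)]] by metis
  have "semidec (\<lambda>c. \<exists>v. R c v)"
    by (intro semidec_basic semidec_comp2[OF R(1)])
  then show ?thesis
    by (intro exI[of _ "\<lambda>c. \<exists>v. R c v"]) (use f R(2) in auto)
qed

text \<open>The set is the domain of an unbounded search for the confirming stage, which is placed
  in front of the argument list; the value of \<open>of_bool (\<not> S ..)\<close> is zero at a
  successful stage.\<close>

lemma semidec_imp_ce: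
  assumes "semidec R"
  shows "ce n {xs. length xs = n \<and> R (tuple xs)}"
proof -
  obtain S where S: "decidable (\<lambda>p. S (fst p) (snd p))" "\<And>x. R x \<longleftrightarrow> (\<exists>k::nat. S x k)"
    using semidecE[OF assms] by metis
  have tuple: "total_recursive m (\<lambda>xs. tuple (map (\<lambda>i. xs ! i) is))" if "set is \<subseteq> {..<m}" for "is" m
    using that by (induction "is") (auto intro: total_recursive_zero total_recursive_prod_encode
        total_recursive_proj)
  have "computable (\<lambda>p. of_bool (\<not> S (fst p) (snd p)) :: nat)"
    using decidable_not[OF S(1)] by (simp add: decidable_def)
  then have *: "computable (\<lambda>c. of_bool (\<not> S (snd (prod_decode c)) (fst (prod_decode c))) :: nat)"
    by (rule computable_comp2) (intro computable_basic)+
  have upt: "set [0..<Suc n] \<subseteq> {..<Suc n}" by auto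
  from computableE[OF *, of "Suc n" "\<lambda>xs. tuple (map (\<lambda>i. xs ! i) [0..<Suc n])"]
  have "total_recursive (Suc n) (\<lambda>xs. (\<lambda>c. of_bool (\<not> S (snd (prod_decode c)) (fst (prod_decode c))))
      (tuple (map (\<lambda>i. xs ! i) [0..<Suc n])))"
    using tuple[OF upt] by (simp del: upt_Suc)
  then have "total_recursive (Suc n) (\<lambda>xs. of_bool (\<not> S (tuple (tl xs)) (hd xs)))"
  proof (rule total_recursive_cong)
    fix xs :: "nat list" assume xs: "length xs = Suc n"
    then have "map (\<lambda>i. xs ! i) [0..<Suc n] = xs"
      by (metis map_nth)
    moreover have "xs \<noteq> []" using xs by auto
    ultimately show "of_bool (\<not> S (snd (prod_decode (tuple (map ((!) xs) [0..<Suc n]))))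
        (fst (prod_decode (tuple (map ((!) xs) [0..<Suc n]))))) = of_bool (\<not> S (tuple (tl xs)) (hd xs))"
      by (simp add: fst_prod_decode_tuple snd_prod_decode_tuple del: upt_Suc)
  qed
  then obtain p where p: "partial_recursive (Suc n) p"
    "\<And>xs. length xs = Suc n \<Longrightarrow> p xs = Some (of_bool (\<not> S (tuple (tl xs)) (hd xs)))"
    unfolding total_recursive_def by metis
  have *: "{xs. length xs = n \<and> R (tuple xs)} = {xs. length xs = n \<and>
      (if \<exists>z. p (z # xs) = Some 0 \<and> (\<forall>y<z. p (y # xs) \<noteq> None)
       then Some (LEAST z. p (z # xs) = Some 0) else None) \<noteq> None}"
    using p(2) S(2) by auto
  show ?thesis
    unfolding ce_def by (intro exI conjI, rule partial_recursive.mu[OF p(1)], rule *)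
qed

lemma ce2_iff: "ce 2 {[i, j] |i j. R i j} \<longleftrightarrow> semidec (\<lambda>p. R (fst p) (snd p))"
proof
  assume *: "ce 2 {[i, j] |i j. R i j}"
  obtain Q where Q: "semidec Q"
    "\<And>xs. length xs = 2 \<Longrightarrow> xs \<in> {[i, j] |i j. R i j} \<longleftrightarrow> Q (tuple xs)"
    using ce_imp_semidec[OF *] by (elim exE conjE) simp
  have "semidec (\<lambda>p. Q (prod_encode (fst p, prod_encode (snd p, 0))))"
    by (intro semidec_comp[OF Q(1)] computable_basic)
  moreover have "R i j \<longleftrightarrow> Q (prod_encode (i, prod_encode (j, 0)))" for i j
    using Q(2)[of "[i, j]"] by simp
  ultimately show "semidec (\<lambda>p. R (fst p) (snd p))" by simp
next
  assume R: "semidec (\<lambda>p. R (fst p) (snd p))"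
  have "semidec (\<lambda>c. R (elt 0 c) (elt 1 c))"
    by (intro semidec_comp2[OF R] computable_elt computable_basic)
  from semidec_imp_ce[OF this, of 2]
  have "ce 2 {xs. length xs = 2 \<and> R (elt 0 (tuple xs)) (elt 1 (tuple xs))}" .
  also have "{xs. length xs = 2 \<and> R (elt 0 (tuple xs)) (elt 1 (tuple xs))} = {[i, j] |i j. R i j}"
    by (auto simp: numeral_2_eq_2 length_Suc_conv)
  finally show "ce 2 {[i, j] |i j. R i j}" .
qed

lemma ce3_iff:
  "ce 3 {[i, j, k] |i j k. R i j k} \<longleftrightarrow> semidec (\<lambda>p. R (fst p) (fst (snd p)) (snd (snd p)))"
proof
  assume *: "ce 3 {[i, j, k] |i j k. R i j k}"
  obtain Q where Q: "semidec Q"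
    "\<And>xs. length xs = 3 \<Longrightarrow> xs \<in> {[i, j, k] |i j k. R i j k} \<longleftrightarrow> Q (tuple xs)"
    using ce_imp_semidec[OF *] by (elim exE conjE) simp
  have "semidec (\<lambda>p. Q (prod_encode (fst p, prod_encode (fst (snd p), prod_encode (snd (snd p), 0)))))"
    by (intro semidec_comp[OF Q(1)] computable_basic)
  moreover have "R i j k \<longleftrightarrow> Q (prod_encode (i, prod_encode (j, prod_encode (k, 0))))" for i j k
    using Q(2)[of "[i, j, k]"] by simp
  ultimately show "semidec (\<lambda>p. R (fst p) (fst (snd p)) (snd (snd p)))" by simp
next
  assume R: "semidec (\<lambda>p. R (fst p) (fst (snd p)) (snd (snd p)))"
  have "semidec (\<lambda>c. R (elt 0 c) (elt 1 c) (elt 2 c))"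
    by (intro semidec_comp3[OF R] computable_elt computable_basic)
  from semidec_imp_ce[OF this, of 3]
  have "ce 3 {xs. length xs = 3 \<and> R (elt 0 (tuple xs)) (elt 1 (tuple xs)) (elt 2 (tuple xs))}" .
  also have "{xs. length xs = 3 \<and> R (elt 0 (tuple xs)) (elt 1 (tuple xs)) (elt 2 (tuple xs))}
      = {[i, j, k] |i j k. R i j k}"
    by (auto simp: eval_nat_numeral length_Suc_conv)
  finally show "ce 3 {[i, j, k] |i j k. R i j k}" .
qed

text \<open>The graph is semidecidable and single-valued, so whatever the selection returns is the
  value of \<open>h\<close>.\<close>

lemma computable2_imp_computable:
  assumes "computable2 h"
  shows "computable (\<lambda>p. h (fst p) (snd p))"
proof -
  obtain f where f: "partial_recursive 2 f" "\<And>m n. f [m, n] = Some (h m n)"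
    using assms unfolding computable2_def by blast
  obtain R where R: "semidec (\<lambda>p. R (fst p) (snd p))"
    "\<And>xs v. length xs = 2 \<Longrightarrow> f xs = Some v \<longleftrightarrow> R (tuple xs) v"
    using graph_semidecE[OF partial_recursive_graph_semidec[OF f(1)]] by metis
  have iff: "R (prod_encode (m, prod_encode (n, 0))) v \<longleftrightarrow> h m n = v" for m n v
    using R(2)[of "[m, n]" v] f(2)[of m n] by simp
  have "semidec (\<lambda>p. R (prod_encode (fst (fst p), prod_encode (snd (fst p), 0))) (snd p))"
    by (intro semidec_comp2[OF R(1)] computable_basic)
  from semidec_select[OF this] obtain g :: "nat \<times> nat \<Rightarrow> nat" where "computable g"
    "\<And>p. R (prod_encode (fst p, prod_encode (snd p, 0))) (g p)"
    using iff by auto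
  then have "computable g" "g = (\<lambda>p. h (fst p) (snd p))"
    by (auto simp: iff)
  then show ?thesis by simp
qed

section \<open>Computable groups\<close>

text \<open>In terms of the basic sets: \<open>W\<close>, \<open>M\<close> and \<open>I\<close> give names of the intersections of two basic
  sets and of the preimages of basic sets under multiplication and inversion.\<close>

locale computable_group = group G for G :: "('a, 'm) monoid_scheme" (structure) +
  fixes B :: "nat \<Rightarrow> 'a set" and W M :: "nat \<Rightarrow> nat \<Rightarrow> nat \<Rightarrow> bool" and I :: "nat \<Rightarrow> nat \<Rightarrow> bool"
  assumes B_nonempty: "B i \<noteq> {}"
    and Union_B: "(\<Union>i. B i) = carrier G"
    and separated: "x \<in> carrier G \<Longrightarrow> y \<in> carrier G \<Longrightarrow> x \<noteq> y \<Longrightarrow> \<exists>k. x \<in> B k \<and> y \<notin> B k"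
    and semidec_W: "semidec (\<lambda>p. W (fst p) (fst (snd p)) (snd (snd p)))"
    and semidec_M: "semidec (\<lambda>p. M (fst p) (fst (snd p)) (snd (snd p)))"
    and semidec_I: "semidec (\<lambda>p. I (fst p) (snd p))"
    and W: "x \<in> B i \<and> x \<in> B j \<longleftrightarrow> (\<exists>k. x \<in> B k \<and> W i j k)"
    and M: "x \<in> carrier G \<Longrightarrow> y \<in> carrier G \<Longrightarrow>
      x \<otimes> y \<in> B k \<longleftrightarrow> (\<exists>i j. x \<in> B i \<and> y \<in> B j \<and> M i j k)"
    and I: "x \<in> carrier G \<Longrightarrow> inv x \<in> B k \<longleftrightarrow> (\<exists>i. x \<in> B i \<and> I i k)"
begin

lemmas W_intro = semidec_comp3[OF semidec_W]
lemmas M_intro = semidec_comp3[OF semidec_M]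
lemmas I_intro = semidec_comp2[OF semidec_I]

lemma B_carrier: "x \<in> B i \<Longrightarrow> x \<in> carrier G"
  using Union_B by blast

lemma ex_B: "x \<in> carrier G \<Longrightarrow> \<exists>i. x \<in> B i"
  using Union_B by blast

lemma W_nonempty: "W i j k \<Longrightarrow> \<exists>x \<in> B k. x \<in> B i \<and> x \<in> B j"
  using B_nonempty W by blast

section \<open>Uniform names of sets built with the group operations\<close>

definition D where "D i j k \<longleftrightarrow> (\<exists>p. I i p \<and> M p j k)"

lemma semidec_D: "semidec (\<lambda>p. D (fst p) (fst (snd p)) (snd (snd p)))"
  unfolding D_def by (intro semidec_basic M_intro I_intro)

lemmas D_intro = semidec_comp3[OF semidec_D]

lemma D:
  assumes "x \<in> carrier G" "y \<in> carrier G"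
  shows "inv x \<otimes> y \<in> B k \<longleftrightarrow> (\<exists>i j. x \<in> B i \<and> y \<in> B j \<and> D i j k)"
proof -
  have "inv x \<otimes> y \<in> B k \<longleftrightarrow> (\<exists>p j. inv x \<in> B p \<and> y \<in> B j \<and> M p j k)"
    using assms by (simp add: M)
  also have "\<dots> \<longleftrightarrow> (\<exists>i j. x \<in> B i \<and> y \<in> B j \<and> D i j k)"
    unfolding I[OF assms(1)] D_def by blast
  finally show ?thesis .
qed

text \<open>\<open>A a m k\<close> verifies \<open>B\<^sub>a B\<^sub>m B\<^sub>m\<^sup>-\<^sup>1 \<subseteq> B\<^sub>k\<close>. It replaces the inclusion \<open>B\<^sub>a V\<^sub>n \<subseteq> B\<^sub>k\<close>, which is
  not semidecidable: \<open>V\<^sub>n \<subseteq> B\<^sub>m B\<^sub>m\<^sup>-\<^sup>1\<close> holds by construction for all \<open>n > m\<close>.\<close>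

definition A where
  "A a m k \<longleftrightarrow> (\<exists>c z p q. M c z k \<and> M a p c \<and> I q z \<and> W p q m)"

lemma semidec_A: "semidec (\<lambda>p. A (fst p) (fst (snd p)) (snd (snd p)))"
  unfolding A_def by (intro semidec_basic M_intro I_intro W_intro)

lemmas A_intro = semidec_comp3[OF semidec_A]

lemma A_mult:
  assumes "A a m k" "x \<in> B a" "g \<in> B m" "h \<in> B m"
  shows "x \<otimes> g \<otimes> inv h \<in> B k"
proof -
  obtain c z p q where *: "M c z k" "M a p c" "I q z" "W p q m"
    using assms(1) unfolding A_def by blast
  have car: "x \<in> carrier G" "g \<in> carrier G" "h \<in> carrier G"
    using assms B_carrier by auto
  have "g \<in> B p" "h \<in> B q"
    using W *(4) assms(3,4) by blast+
  then have "x \<otimes> g \<in> B c" "inv h \<in> B z"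
    using M[of x g c] I[of h z] car assms(2) * by blast+
  then show ?thesis
    using M[of "x \<otimes> g" "inv h" k] car * by blast
qed

text \<open>Continuity at \<open>(x, \<one>, \<one>)\<close>, as
  \<open>x = x \<otimes> \<one> \<otimes> inv \<one>\<close>. The neighbourhoods of the two units
  are intersected to obtain the single set \<open>B m\<close>.\<close>

lemma ex_A:
  assumes "x \<in> B k"
  shows "\<exists>a m. A a m k \<and> x \<in> B a"
proof -
  have x: "x \<in> carrier G" using assms B_carrier by blast
  then have x1: "x \<otimes> \<one> \<in> carrier G" and "(x \<otimes> \<one>) \<otimes> inv \<one> \<in> B k"
    using assms by simp_all
  then obtain c z where cz: "x \<otimes> \<one> \<in> B c" "inv \<one> \<in> B z" "M c z k"
    using M[OF x1 inv_closed[OF one_closed], of k] by blast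
  obtain a p where ap: "x \<in> B a" "\<one> \<in> B p" "M a p c"
    using M[OF x one_closed, of c] cz(1) by blast
  obtain q where q: "\<one> \<in> B q" "I q z"
    using I[OF one_closed, of z] cz(2) by blast
  obtain m where "W p q m" using W ap q by blast
  then show ?thesis unfolding A_def using cz ap q by blast
qed

text \<open>\<open>z\<close> lies in \<open>B\<^sub>m B\<^sub>m\<^sup>-\<^sup>1\<close> iff
  \<open>inv z \<otimes> g\<close> lies in \<open>B m\<close> for some \<open>g\<close> in
  \<open>B m\<close>. For \<open>z\<close> in \<open>B i\<close> and \<open>g\<close> in
  \<open>B j\<close> this is verified by \<open>D i j m\<close>, and \<open>W j m w\<close>
  certifies that \<open>B j\<close> contains a point of \<open>B m\<close>, since \<open>B w\<close>
  is non-empty.\<close>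

definition NC where "NC m i \<longleftrightarrow> (\<exists>j w. D i j m \<and> W j m w)"

lemma semidec_NC: "semidec (\<lambda>p. NC (fst p) (snd p))"
  unfolding NC_def by (intro semidec_basic D_intro W_intro)

lemmas NC_intro = semidec_comp2[OF semidec_NC]

lemma in_mult_inv_iff:
  "z \<in> X <#> set_inv Y \<longleftrightarrow> (\<exists>g\<in>X. \<exists>h\<in>Y. z = g \<otimes> inv h)"
  unfolding set_mult_def SET_INV_def by blast

lemma NC:
  assumes z: "z \<in> carrier G"
  shows "z \<in> B m <#> set_inv (B m) \<longleftrightarrow> (\<exists>i. z \<in> B i \<and> NC m i)"
proof
  assume "z \<in> B m <#> set_inv (B m)"
  then obtain g h where gh: "g \<in> B m" "h \<in> B m" "z = g \<otimes> inv h"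
    unfolding in_mult_inv_iff by blast
  have car: "g \<in> carrier G" "h \<in> carrier G" using gh B_carrier by blast+
  have "inv z \<otimes> g = h"
    using car gh(3) by (simp add: inv_mult_group m_assoc)
  then have "inv z \<otimes> g \<in> B m" using gh by simp
  then obtain i j where ij: "z \<in> B i" "g \<in> B j" "D i j m"
    using D[OF z car(1)] by blast
  then obtain w where "W j m w" using W gh by blast
  then show "\<exists>i. z \<in> B i \<and> NC m i" unfolding NC_def using ij by blast
next
  assume "\<exists>i. z \<in> B i \<and> NC m i"
  then obtain i j w where *: "z \<in> B i" "D i j m" "W j m w" unfolding NC_def by blast
  then obtain g where g: "g \<in> B j" "g \<in> B m" using W_nonempty by blast
  then have car: "g \<in> carrier G" using B_carrier by blast
  have "inv z \<otimes> g \<in> B m" using D[OF z car] * g by blast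
  moreover have "z = g \<otimes> inv (inv z \<otimes> g)"
    using z car by (simp add: inv_mult_group flip: m_assoc)
  ultimately show "z \<in> B m <#> set_inv (B m)"
    unfolding in_mult_inv_iff using g by blast
qed

text \<open>Intersecting with one more factor replaces an index \<open>k\<close> by those in the
  name of \<open>B k \<inter> B c\<close>. The recursion starts from the true predicate because all
  basic sets together name the whole group.\<close>

definition NU where
  "NU n k = rec_nat (\<lambda>_. True) (\<lambda>m Q k'. \<exists>k. Q k \<and> (\<exists>c. NC m c \<and> W k c k')) n k"

lemma semidec_NU: "semidec (\<lambda>p. NU (fst p) (snd p))"
  unfolding NU_def
  by (rule semidec_iterate[where Q = "\<lambda>_ _. True" and f = "\<lambda>x. 0 :: nat" and
        S = "\<lambda>_ m k k'. \<exists>c. NC m c \<and> W k c k'"])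
    (intro semidec_True semidec_basic NC_intro W_intro)+

lemmas NU_intro = semidec_comp2[OF semidec_NU]

lemma NU: "z \<in> carrier G \<Longrightarrow> z \<in> U_seq G B n \<longleftrightarrow> (\<exists>k. z \<in> B k \<and> NU n k)"
proof (induction n)
  case 0
  then show ?case using ex_B by (simp add: NU_def)
next
  case (Suc n)
  have "z \<in> U_seq G B (Suc n) \<longleftrightarrow> (\<exists>k. z \<in> B k \<and> NU n k) \<and> (\<exists>c. z \<in> B c \<and> NC n c)"
    using Suc NC by auto
  also have "\<dots> \<longleftrightarrow> (\<exists>k c. (z \<in> B k \<and> z \<in> B c) \<and> NU n k \<and> NC n c)" by blast
  also have "\<dots> \<longleftrightarrow> (\<exists>k'. z \<in> B k' \<and> NU (Suc n) k')"
    unfolding W NU_def by auto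
  finally show ?case .
qed

end

section \<open>The neighbourhoods \<open>V n\<close> of the identity\<close>

locale computable_group_search = computable_group +
  fixes s :: "nat \<Rightarrow> nat list"
  assumes hit: "search_hit G B (V_seq G B s n) (s n)"
    and computable_last: "computable (\<lambda>n. last (s n))"
begin

abbreviation "V \<equiv> V_seq G B s"

definition NV where
  "NV n k \<longleftrightarrow> n = 0 \<or> (\<exists>m c c'. n = Suc m \<and> NC (last (s m)) c \<and> NU n c' \<and> W c c' k)"

lemma semidec_NV: "semidec (\<lambda>p. NV (fst p) (snd p))"
  unfolding NV_def
  by (intro semidec_basic NC_intro NU_intro W_intro computable_comp[OF computable_last])

lemmas NV_intro = semidec_comp2[OF semidec_NV]

lemma V_carrier: "V n \<subseteq> carrier G"
proof (induction n)
  case (Suc n)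
  have "U_seq G B m \<subseteq> carrier G" for m by (induction m) auto
  then show ?case by fastforce
qed auto

lemma NV: "z \<in> carrier G \<Longrightarrow> z \<in> V n \<longleftrightarrow> (\<exists>k. z \<in> B k \<and> NV n k)"
proof (cases n)
  case 0
  then show "z \<in> carrier G \<Longrightarrow> ?thesis" using ex_B by (simp add: NV_def)
next
  case (Suc m)
  assume z: "z \<in> carrier G"
  have "z \<in> V n \<longleftrightarrow> (\<exists>c. z \<in> B c \<and> NC (last (s m)) c) \<and> (\<exists>c'. z \<in> B c' \<and> NU n c')"
    using Suc NC[OF z] NU[OF z, of n] by simp
  also have "\<dots> \<longleftrightarrow> (\<exists>c c'. (z \<in> B c \<and> z \<in> B c') \<and> NC (last (s m)) c \<and> NU n c')" by blast
  also have "\<dots> \<longleftrightarrow> (\<exists>k. z \<in> B k \<and> NV n k)"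
    unfolding W NV_def using Suc by auto
  finally show ?thesis .
qed

lemma one_in_mult_inv: "\<one> \<in> B m <#> set_inv (B m)"
  unfolding in_mult_inv_iff using B_nonempty[of m] B_carrier by (metis all_not_in_conv r_inv)

lemma one_V: "\<one> \<in> V n"
proof (cases n)
  case (Suc m)
  have "\<one> \<in> U_seq G B k" for k by (induction k) (auto simp: one_in_mult_inv)
  then show ?thesis using Suc one_in_mult_inv by simp
qed simp

lemma inv_in_mult_inv: "z \<in> B m <#> set_inv (B m) \<Longrightarrow> inv z \<in> B m <#> set_inv (B m)"
  unfolding in_mult_inv_iff using B_carrier by (metis inv_closed inv_inv inv_mult_group)

lemma inv_V:
  assumes "z \<in> V n"
  shows "inv z \<in> V n"
proof (cases n)
  case (Suc m)
  have "z \<in> U_seq G B k \<Longrightarrow> inv z \<in> U_seq G B k" for k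
    by (induction k) (auto simp: inv_in_mult_inv)
  then show ?thesis using Suc assms inv_in_mult_inv by simp
qed (use assms in auto)

text \<open>This is what the map of six arguments in the search is for.\<close>

lemma V_cube:
  assumes "a \<in> V (Suc n)" "b \<in> V (Suc n)" "c \<in> V (Suc n)"
  shows "a \<otimes> b \<otimes> c \<in> V n"
proof -
  obtain i0 i1 i2 i3 i4 i5 m where m: "s n = [i0, i1, i2, i3, i4, i5, m]"
    and sub: "B i0 \<times> B i1 \<times> B i2 \<times> B i3 \<times> B i4 \<times> B i5 \<subseteq> six_fold G -` V n"
    and Bm: "B m \<subseteq> V n \<inter> (B i0 \<inter> B i1 \<inter> B i2 \<inter> B i3 \<inter> B i4 \<inter> B i5)"
    using hit[of n] unfolding search_hit_def by (elim exE conjE)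
  have "\<exists>g\<in>B m. \<exists>h\<in>B m. z = g \<otimes> inv h" if "z \<in> V (Suc n)" for z
    using that m by (simp add: in_mult_inv_iff)
  then obtain a1 a2 b1 b2 c1 c2 where *: "a = a1 \<otimes> inv a2" "b = b1 \<otimes> inv b2" "c = c1 \<otimes> inv c2"
    "a1 \<in> B m" "a2 \<in> B m" "b1 \<in> B m" "b2 \<in> B m" "c1 \<in> B m" "c2 \<in> B m"
    using assms by metis
  then have "(a1, a2, b1, b2, c1, c2) \<in> B i0 \<times> B i1 \<times> B i2 \<times> B i3 \<times> B i4 \<times> B i5"
    using Bm by auto
  then have "six_fold G (a1, a2, b1, b2, c1, c2) \<in> V n"
    using sub by blast
  moreover have "six_fold G (a1, a2, b1, b2, c1, c2) = a \<otimes> b \<otimes> c"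
    unfolding six_fold_def using * B_carrier by (simp add: m_assoc)
  ultimately show ?thesis by simp
qed

lemma V_Suc_subset: "V (Suc n) \<subseteq> V n"
proof
  fix z assume z: "z \<in> V (Suc n)"
  then have "z \<in> carrier G" using V_carrier by blast
  then show "z \<in> V n" using V_cube[OF z one_V one_V] by simp
qed

lemma V_antimono: "m \<le> n \<Longrightarrow> V n \<subseteq> V m"
  using lift_Suc_antimono_le[of V] V_Suc_subset by blast

lemma V_subset_mult_inv: "m < n \<Longrightarrow> V n \<subseteq> B m <#> set_inv (B m)"
proof -
  assume "m < n"
  then have "V n \<subseteq> V (Suc m)" by (intro V_antimono) simp
  then show ?thesis by auto
qed

lemma V_translate_subset_B:
  assumes "A a m k" "x \<in> B a" "m < n" "inv x \<otimes> y \<in> V n" "y \<in> carrier G"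
  shows "y \<in> B k"
proof -
  obtain g h where gh: "inv x \<otimes> y = g \<otimes> inv h" "g \<in> B m" "h \<in> B m"
    using V_subset_mult_inv[OF assms(3)] assms(4) in_mult_inv_iff by blast
  have car: "x \<in> carrier G" "g \<in> carrier G" "h \<in> carrier G"
    using assms gh B_carrier by auto
  have "y = x \<otimes> (inv x \<otimes> y)"
    using car assms(5) by (simp flip: m_assoc)
  also have "\<dots> = x \<otimes> g \<otimes> inv h"
    using car gh(1) by (simp add: m_assoc)
  finally show ?thesis using A_mult[OF assms(1,2) gh(2,3)] by simp
qed

text \<open>Together with \<open>translate_contains_B\<close> this makes the translates
  \<open>x V\<^sub>n\<close> a neighbourhood base at \<open>x\<close> for the given topology.
  Compatibility of \<open>d\<close> comes from both halves, the separation of points by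
  \<open>d\<close> from this one.\<close>

lemma B_contains_translate:
  assumes "x \<in> B k"
  shows "\<exists>n. \<forall>y\<in>carrier G. inv x \<otimes> y \<in> V n \<longrightarrow> y \<in> B k"
  using ex_A[OF assms] V_translate_subset_B by blast

text \<open>Continuity of \<open>inv x \<otimes> y\<close> at \<open>(x, x)\<close>, where its value
  is the identity, an element of the open set \<open>V n\<close>.\<close>

lemma translate_contains_B:
  assumes x: "x \<in> carrier G"
  shows "\<exists>k. x \<in> B k \<and> (\<forall>y\<in>B k. inv x \<otimes> y \<in> V n)"
proof -
  obtain k where k: "\<one> \<in> B k" "NV n k" using NV[of \<one> n] one_V by auto
  then have "inv x \<otimes> x \<in> B k" using x by simp
  then obtain i j where ij: "x \<in> B i" "x \<in> B j" "D i j k" using D[OF x x] by blast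
  have "inv x \<otimes> y \<in> V n" if "y \<in> B j" for y
  proof -
    have y: "y \<in> carrier G" using that B_carrier by blast
    then have "inv x \<otimes> y \<in> B k" using D[OF x y] ij that by blast
    then show ?thesis using NV[of "inv x \<otimes> y" n] k x y by auto
  qed
  then show ?thesis using ij by blast
qed

section \<open>Weighted products of the sets \<open>V n\<close>\<close>

primrec prodV :: "nat list \<Rightarrow> 'a set" where
  "prodV [] = {\<one>}"
| "prodV (n # ns) = V n <#> prodV ns"

text \<open>A list stands for a chain whose successive steps lie in the sets \<open>V n\<close>,
  with \<open>n\<close> running through the list. A step in \<open>V n\<close> has
  \<open>rho\<close> at most \<open>(1/2) ^ n\<close>, so the weight bounds the length of the
  chain.\<close>

definition wt :: "nat list \<Rightarrow> real" where
  "wt ns = (\<Sum>n\<leftarrow>ns. (1/2) ^ n)"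

lemma wt_simps [simp]: "wt [] = 0" "wt (n # ns) = (1/2) ^ n + wt ns" "wt (ms @ ns) = wt ms + wt ns"
  "wt (rev ns) = wt ns"
  by (simp_all add: wt_def sum_list_rev flip: rev_map)

lemma wt_nonneg: "0 \<le> wt ns"
  by (induction ns) auto

lemma prodV_carrier: "prodV ns \<subseteq> carrier G"
  using set_mult_closed[OF V_carrier] by (induction ns) simp_all

lemma in_set_mult_iff: "z \<in> X <#> Y \<longleftrightarrow> (\<exists>g\<in>X. \<exists>h\<in>Y. z = g \<otimes> h)"
  unfolding set_mult_def by blast

lemma prodV_append: "prodV (ms @ ns) = prodV ms <#> prodV ns"
proof (induction ms)
  case Nil
  have "{\<one>} <#> prodV ns = (\<lambda>x. \<one> \<otimes> x) ` prodV ns" by (auto simp: in_set_mult_iff)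
  also have "\<dots> = (\<lambda>x. x) ` prodV ns"
    by (rule image_cong) (use subsetD[OF prodV_carrier] in auto)
  finally show ?case by simp
next
  case (Cons m ms)
  then show ?case by (simp add: set_mult_assoc prodV_carrier V_carrier)
qed

lemma prodV_singleton: "prodV [n] = V n"
proof -
  have "V n <#> {\<one>} = (\<lambda>x. x \<otimes> \<one>) ` V n" by (auto simp: in_set_mult_iff)
  also have "\<dots> = (\<lambda>x. x) ` V n"
    by (rule image_cong) (use subsetD[OF V_carrier] in auto)
  finally show ?thesis by simp
qed

lemma inv_prodV: "z \<in> prodV ns \<Longrightarrow> inv z \<in> prodV (rev ns)"
proof (induction ns arbitrary: z)
  case (Cons n ns)
  then obtain g h where gh: "g \<in> V n" "h \<in> prodV ns" "z = g \<otimes> h"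
    by (auto simp: in_set_mult_iff)
  then have "inv z = inv h \<otimes> inv g"
    using V_carrier prodV_carrier by (intro inv_mult_group[of g h, folded gh(3)]) auto
  moreover have "inv h \<in> prodV (rev ns)" "inv g \<in> V n"
    using gh Cons.IH inv_V by auto
  ultimately show ?case
    by (auto simp: prodV_append prodV_singleton in_set_mult_iff simp del: prodV.simps(2))
qed simp

text \<open>Cut at the first entry after which less than \<open>e'\<close> remains. Unless this is
  the very first entry, at least \<open>e'\<close> is left from it onwards, so less than
  \<open>e\<close> lies before it.\<close>

lemma split_weight:
  assumes "wt ns < e + e'" "0 < e" "0 < e'" "ns \<noteq> []"
  shows "\<exists>us m vs. ns = us @ m # vs \<and> wt us < e \<and> wt vs < e'"
  using assms
proof (induction ns arbitrary: e)
  case (Cons n ns)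
  show ?case
  proof (cases "wt ns < e'")
    case True
    then show ?thesis using Cons.prems by (intro exI[of _ "[]"] exI[of _ n] exI[of _ ns]) simp
  next
    case False
    then have "wt ns < (e - (1/2) ^ n) + e'" "0 < e - (1/2) ^ n" "ns \<noteq> []"
      using Cons.prems by auto
    then obtain us m vs where "ns = us @ m # vs" "wt us < e - (1/2) ^ n" "wt vs < e'"
      using Cons.IH Cons.prems(3) by blast
    then show ?thesis by (intro exI[of _ "n # us"] exI[of _ m] exI[of _ vs]) simp
  qed
qed simp

text \<open>The Birkhoff--Kakutani estimate: cut the product at the middle of its weight and use
  \<open>V\<^sub>n\<^sub>+\<^sub>1 V\<^sub>n\<^sub>+\<^sub>1 V\<^sub>n\<^sub>+\<^sub>1 \<subseteq> V\<^sub>n\<close>.\<close>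

lemma prodV_subset_V: "wt ns < (1/2) ^ n \<Longrightarrow> prodV ns \<subseteq> V n"
proof (induction "length ns" arbitrary: ns n rule: less_induct)
  case less
  show ?case
  proof (cases "ns = []")
    case True
    then show ?thesis using one_V by simp
  next
    case False
    have "wt ns < (1/2) ^ Suc n + (1/2) ^ Suc n" using less.prems by simp
    from split_weight[OF this _ _ False] obtain us m vs where ns: "ns = us @ m # vs"
      and us: "wt us < (1/2) ^ Suc n" and vs: "wt vs < (1/2) ^ Suc n" by auto
    \<comment> \<open>The factor at the cut belongs to neither half, but its weight alone is below
      \<open>(1/2) ^ n\<close>, so its index exceeds \<open>n\<close>.\<close>
    have "(1/2 :: real) ^ m \<le> wt ns"
      using wt_nonneg[of us] wt_nonneg[of vs] by (simp add: ns)
    then have "(1/2 :: real) ^ m < (1/2) ^ n" using less.prems by linarith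
    then have "n < m" by (simp add: power_strict_decreasing_iff)
    then have Vm: "V m \<subseteq> V (Suc n)" by (intro V_antimono) simp
    have "prodV us \<subseteq> V (Suc n)" "prodV vs \<subseteq> V (Suc n)"
      using less.hyps us vs by (auto simp: ns simp del: V_seq.simps)
    note sub = this Vm
    show ?thesis
    proof
      fix z assume "z \<in> prodV ns"
      then have "z \<in> prodV us <#> (V m <#> prodV vs)"
        by (simp add: ns prodV_append)
      then obtain a w where "z = a \<otimes> w" "a \<in> prodV us" "w \<in> V m <#> prodV vs"
        by (auto simp: in_set_mult_iff[of z])
      then obtain b c where z: "z = a \<otimes> (b \<otimes> c)" "a \<in> prodV us" "b \<in> V m" "c \<in> prodV vs"
        by (auto simp: in_set_mult_iff[of w])
      then have V: "a \<in> V (Suc n)" "b \<in> V (Suc n)" "c \<in> V (Suc n)"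
        using sub by blast+
      have "z = a \<otimes> b \<otimes> c"
        using V[THEN subsetD[OF V_carrier]] z(1) by (simp add: m_assoc)
      then show "z \<in> V n" using V_cube[OF V] by simp
    qed
  qed
qed

subsection \<open>The chain metric\<close>

abbreviation "d \<equiv> chain_metric G V"

lemma mult_inv_mult_cancel: "x \<in> carrier G \<Longrightarrow> y \<in> carrier G \<Longrightarrow> x \<otimes> (inv x \<otimes> y) = y"
  by (simp flip: m_assoc)

lemma inv_mult_split:
  "x \<in> carrier G \<Longrightarrow> y \<in> carrier G \<Longrightarrow> z \<in> carrier G \<Longrightarrow>
    inv x \<otimes> z = (inv x \<otimes> y) \<otimes> (inv y \<otimes> z)"
  by (simp add: m_assoc mult_inv_mult_cancel)

lemma rho_set: "{(1/2) ^ n |n. inv x \<otimes> y \<in> V n} = (\<lambda>n. (1/2 :: real) ^ n) ` {n. inv x \<otimes> y \<in> V n}"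
  by blast

text \<open>Infima are handled through strict upper bounds: for \<open>x = y\<close> the infimum is
  \<open>0\<close> and is not attained.\<close>

lemma rho_less_iff:
  assumes "x \<in> carrier G" "y \<in> carrier G"
  shows "rho G V x y < r \<longleftrightarrow> (\<exists>n. inv x \<otimes> y \<in> V n \<and> (1/2) ^ n < r)"
proof -
  have "{n. inv x \<otimes> y \<in> V n} \<noteq> {}" using assms by (auto intro: exI[of _ 0])
  moreover have "bdd_below ((\<lambda>n. (1/2 :: real) ^ n) ` {n. inv x \<otimes> y \<in> V n})"
    by (rule bdd_belowI[of _ 0]) auto
  ultimately show ?thesis
    unfolding rho_def rho_set by (subst cInf_less_iff) auto
qed

lemma rho_le: "x \<in> carrier G \<Longrightarrow> y \<in> carrier G \<Longrightarrow> inv x \<otimes> y \<in> V n \<Longrightarrow> rho G V x y \<le> (1/2) ^ n"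
  using rho_less_iff[of x y "rho G V x y"] by force

lemma rho_nonneg:
  assumes "x \<in> carrier G" "y \<in> carrier G"
  shows "0 \<le> rho G V x y"
proof (rule ccontr)
  assume "\<not> 0 \<le> rho G V x y"
  then obtain n where "(1/2 :: real) ^ n < 0" using rho_less_iff[OF assms, of 0] by auto
  then show False by (simp add: not_less[symmetric])
qed

text \<open>The partial products of a factorisation, translated by \<open>x\<close>, are the
  vertices of a chain; \<open>chain_prodV\<close> is the converse. Only quotients of neighbouring
  vertices matter, so the starting point is arbitrary.\<close>

lemma ex_chain:
  assumes "z \<in> prodV ns" "x \<in> carrier G"
  shows "\<exists>g. (\<forall>i\<le>length ns. g i \<in> carrier G) \<and> g 0 = x \<and> g (length ns) = x \<otimes> z \<and>
    (\<forall>i<length ns. inv (g i) \<otimes> g (Suc i) \<in> V (ns ! i))"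
  using assms
proof (induction ns arbitrary: x z)
  case Nil
  then show ?case by (intro exI[of _ "\<lambda>_. x"]) auto
next
  case (Cons n ns)
  obtain v w where vw: "v \<in> V n" "w \<in> prodV ns" "z = v \<otimes> w"
    using Cons.prems(1) by (auto simp: in_set_mult_iff)
  have car: "v \<in> carrier G" "w \<in> carrier G" using vw V_carrier prodV_carrier by blast+
  have "x \<otimes> v \<in> carrier G" using car Cons.prems by simp
  from Cons.IH[OF vw(2) this] obtain g where g: "\<forall>i\<le>length ns. g i \<in> carrier G" "g 0 = x \<otimes> v"
    "g (length ns) = x \<otimes> v \<otimes> w" "\<forall>i<length ns. inv (g i) \<otimes> g (Suc i) \<in> V (ns ! i)"
    by (elim exE conjE)
  have 0: "inv x \<otimes> (x \<otimes> v) = v" using car Cons.prems by (simp flip: m_assoc)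
  let ?g = "case_nat x g"
  have "?g i \<in> carrier G" if "i \<le> length (n # ns)" for i
    using that g(1) Cons.prems by (cases i) auto
  moreover have "?g (length (n # ns)) = x \<otimes> z"
    using g(3) car Cons.prems vw(3) by (simp add: m_assoc)
  moreover have "inv (?g i) \<otimes> ?g (Suc i) \<in> V ((n # ns) ! i)" if "i < length (n # ns)" for i
    using that g 0 vw(1) by (cases i) auto
  ultimately show ?case by (intro exI[of _ ?g]) auto
qed

lemma chain_prodV:
  assumes "\<forall>i\<le>l. g i \<in> carrier G" "\<forall>i<l. inv (g i) \<otimes> g (Suc i) \<in> V (f i)"
  shows "inv (g 0) \<otimes> g l \<in> prodV (map f [0..<l])"
  using assms
proof (induction l)
  case (Suc l)
  have car: "g 0 \<in> carrier G" "g l \<in> carrier G" "g (Suc l) \<in> carrier G" using Suc.prems by auto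
  have *: "inv (g 0) \<otimes> g (Suc l) = (inv (g 0) \<otimes> g l) \<otimes> (inv (g l) \<otimes> g (Suc l))"
    using car by (rule inv_mult_split)
  have "inv (g 0) \<otimes> g l \<in> prodV (map f [0..<l])" "inv (g l) \<otimes> g (Suc l) \<in> V (f l)"
    using Suc by auto
  then have "inv (g 0) \<otimes> g (Suc l) \<in> prodV (map f [0..<l] @ [f l])"
    unfolding prodV_append prodV_singleton * in_set_mult_iff by blast
  then show ?case by simp
qed simp

lemma wt_map: "wt (map f [0..<l]) = (\<Sum>i<l. (1/2) ^ f i)"
  by (simp add: wt_def comp_def interv_sum_list_conv_sum_set_nat atLeast0LessThan)

lemma wt_eq_sum: "wt ns = (\<Sum>i<length ns. (1/2) ^ (ns ! i))"
  using wt_map[of "\<lambda>i. ns ! i" "length ns"] by (simp add: map_nth)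

definition chain_sums :: "'a \<Rightarrow> 'a \<Rightarrow> real set" where
  "chain_sums x y = {\<Sum>i=0..l. rho G V (g i) (g (Suc i)) |l g.
                  (\<forall>i\<le>Suc l. g i \<in> carrier G) \<and> g 0 = x \<and> g (Suc l) = y}"

lemma chain_sums_nonneg: "t \<in> chain_sums x y \<Longrightarrow> 0 \<le> t"
  unfolding chain_sums_def by (auto intro!: sum_nonneg rho_nonneg)

lemma chain_sums_nonempty:
  assumes "x \<in> carrier G" "y \<in> carrier G"
  shows "chain_sums x y \<noteq> {}"
proof -
  let ?g = "\<lambda>i::nat. if i = 0 then x else y"
  have "(\<Sum>i=0..0. rho G V (?g i) (?g (Suc i))) \<in> chain_sums x y"
    unfolding chain_sums_def mem_Collect_eq
    by (rule exI[of _ 0], rule exI[of _ ?g]) (use assms in auto)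
  then show ?thesis by blast
qed

lemma d_eq: "x \<in> carrier G \<Longrightarrow> y \<in> carrier G \<Longrightarrow> d x y = Inf (chain_sums x y)"
  unfolding chain_metric_def chain_sums_def by simp

lemma d_nonneg: "0 \<le> d x y"
proof (cases "x \<in> carrier G \<and> y \<in> carrier G")
  case True
  then show ?thesis
    using chain_sums_nonempty chain_sums_nonneg by (auto simp: d_eq intro!: cInf_greatest)
qed (auto simp: chain_metric_def)

text \<open>Chains of points become factorisations of \<open>inv x \<otimes> y\<close>, which depend
  on lists of numbers only. Symmetry, the triangle inequality, the comparison with the sets
  \<open>V n\<close> and the names of balls are all derived from this form.\<close>

lemma d_less_iff:
  assumes x: "x \<in> carrier G" and y: "y \<in> carrier G"
  shows "d x y < r \<longleftrightarrow> (\<exists>ns. wt ns < r \<and> inv x \<otimes> y \<in> prodV ns)"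
proof
  assume "d x y < r"
  then obtain t where "t \<in> chain_sums x y" "t < r"
    using d_eq[OF x y] chain_sums_nonempty[OF x y] cInf_lessD by metis
  then obtain l g where lg: "(\<Sum>i=0..l. rho G V (g i) (g (Suc i))) < r"
    "\<forall>i\<le>Suc l. g i \<in> carrier G" "g 0 = x" "g (Suc l) = y"
    unfolding chain_sums_def by (auto simp only: mem_Collect_eq)
  define s where "s = (\<Sum>i<Suc l. rho G V (g i) (g (Suc i)))"
  have s: "s < r"
    using lg(1) unfolding s_def by (simp only: lessThan_Suc_atMost atLeast0AtMost)
  \<comment> \<open>Each \<open>rho\<close> is only an infimum, so the slack \<open>r - s\<close> is
    distributed evenly over the \<open>Suc l\<close> steps.\<close>
  define e where "e = (r - s) / real (Suc l)"
  have "0 < e" using s by (simp add: e_def)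
  have "\<exists>n. i < Suc l \<longrightarrow> inv (g i) \<otimes> g (Suc i) \<in> V n \<and> (1/2) ^ n < rho G V (g i) (g (Suc i)) + e" for i
  proof (cases "i < Suc l")
    case True
    then show ?thesis
      using rho_less_iff[of "g i" "g (Suc i)" "rho G V (g i) (g (Suc i)) + e"] lg(2) \<open>0 < e\<close> by auto
  qed auto
  then obtain f where f: "\<And>i. i < Suc l \<Longrightarrow> inv (g i) \<otimes> g (Suc i) \<in> V (f i)"
    "\<And>i. i < Suc l \<Longrightarrow> (1/2) ^ f i < rho G V (g i) (g (Suc i)) + e"
    by metis
  have "wt (map f [0..<Suc l]) = (\<Sum>i<Suc l. (1/2) ^ f i)" by (rule wt_map)
  also have "\<dots> < (\<Sum>i<Suc l. rho G V (g i) (g (Suc i)) + e)"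
    by (rule sum_strict_mono) (use f(2) in auto)
  also have "\<dots> = s + real (Suc l) * e"
    by (simp add: s_def sum.distrib)
  also have "\<dots> = r" by (simp add: e_def)
  finally have "wt (map f [0..<Suc l]) < r" .
  moreover have "inv (g 0) \<otimes> g (Suc l) \<in> prodV (map f [0..<Suc l])"
    by (rule chain_prodV) (use lg(2) f(1) in auto)
  ultimately show "\<exists>ns. wt ns < r \<and> inv x \<otimes> y \<in> prodV ns"
    unfolding lg(3,4) by blast
next
  assume "\<exists>ns. wt ns < r \<and> inv x \<otimes> y \<in> prodV ns"
  then obtain ns where ns: "wt ns < r" "inv x \<otimes> y \<in> prodV ns" by blast
  \<comment> \<open>Chains in the definition of \<open>d\<close> have at least one step. The empty
    factorisation is therefore replaced by a single factor \<open>V N\<close> of weight below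
    \<open>r\<close>, which contains the identity.\<close>
  have "\<exists>ns. ns \<noteq> [] \<and> wt ns < r \<and> inv x \<otimes> y \<in> prodV ns"
  proof (cases ns)
    case Nil
    then obtain N where "(1/2 :: real) ^ N < r"
      using ns(1) real_arch_pow_inv[of r "1/2"] by auto
    then show ?thesis
      using ns(2) Nil one_V[of N] by (intro exI[of _ "[N]"]) (simp add: prodV_singleton del: prodV.simps(2))
  qed (use ns in blast)
  then obtain ns where ns: "ns \<noteq> []" "wt ns < r" "inv x \<otimes> y \<in> prodV ns" by blast
  have xy: "x \<otimes> (inv x \<otimes> y) = y" using x y by (rule mult_inv_mult_cancel)
  from ex_chain[OF ns(3) x] obtain g where g: "\<forall>i\<le>length ns. g i \<in> carrier G" "g 0 = x"
    "g (length ns) = y" "\<forall>i<length ns. inv (g i) \<otimes> g (Suc i) \<in> V (ns ! i)"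
    unfolding xy by (elim exE conjE)
  obtain l where l: "length ns = Suc l" using ns(1) by (cases ns) auto
  have "(\<Sum>i=0..l. rho G V (g i) (g (Suc i))) \<le> (\<Sum>i=0..l. (1/2) ^ (ns ! i))"
    by (rule sum_mono, rule rho_le) (use g l in auto)
  also have "\<dots> = wt ns"
    by (simp only: wt_eq_sum l lessThan_Suc_atMost atLeast0AtMost)
  finally have "(\<Sum>i=0..l. rho G V (g i) (g (Suc i))) < r" using ns(2) by simp
  moreover have "(\<Sum>i=0..l. rho G V (g i) (g (Suc i))) \<in> chain_sums x y"
    unfolding chain_sums_def mem_Collect_eq
    by (rule exI[of _ l], rule exI[of _ g]) (use g l in auto)
  moreover have "bdd_below (chain_sums x y)"
    by (rule bdd_belowI[of _ 0]) (rule chain_sums_nonneg)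
  ultimately show "d x y < r"
    unfolding d_eq[OF x y] using cInf_lower order_le_less_trans by blast
qed

lemma d_less_imp_V:
  "x \<in> carrier G \<Longrightarrow> y \<in> carrier G \<Longrightarrow> d x y < (1/2) ^ n \<Longrightarrow> inv x \<otimes> y \<in> V n"
  unfolding d_less_iff using prodV_subset_V by blast

lemma V_imp_d_le:
  assumes "x \<in> carrier G" "y \<in> carrier G" "inv x \<otimes> y \<in> V n"
  shows "d x y \<le> (1/2) ^ n"
proof (rule field_le_epsilon)
  fix e :: real assume "0 < e"
  then have "wt [n] < (1/2) ^ n + e" by simp
  moreover have "inv x \<otimes> y \<in> prodV [n]" using assms(3) by (simp only: prodV_singleton)
  ultimately have "d x y < (1/2) ^ n + e" using d_less_iff assms by blast
  then show "d x y \<le> (1/2) ^ n + e" by simp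
qed

text \<open>Inverting a product reverses its factors, and each \<open>V n\<close> is symmetric, so
  the weight does not change.\<close>

lemma d_commute_le:
  assumes x: "x \<in> carrier G" and y: "y \<in> carrier G"
  shows "d y x \<le> d x y"
proof (rule dense_ge)
  fix r assume "d x y < r"
  then obtain ns where ns: "wt ns < r" "inv x \<otimes> y \<in> prodV ns" using d_less_iff[OF x y] by blast
  have "inv y \<otimes> x = inv (inv x \<otimes> y)" using x y by (simp add: inv_mult_group)
  then have "inv y \<otimes> x \<in> prodV (rev ns)" using inv_prodV[OF ns(2)] by simp
  then have "d y x < r" using d_less_iff[OF y x] ns(1) wt_simps(4) by metis
  then show "d y x \<le> r" by simp
qed

lemma d_triangle:
  assumes x: "x \<in> carrier G" and y: "y \<in> carrier G" and z: "z \<in> carrier G"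
  shows "d x z \<le> d x y + d y z"
proof (rule dense_ge)
  fix r assume "d x y + d y z < r"
  define e where "e = (r - (d x y + d y z)) / 2"
  have "d x y < d x y + e" "d y z < d y z + e"
    using \<open>d x y + d y z < r\<close> by (auto simp: e_def)
  then obtain ms ns where *: "wt ms < d x y + e" "inv x \<otimes> y \<in> prodV ms"
    "wt ns < d y z + e" "inv y \<otimes> z \<in> prodV ns"
    using d_less_iff[OF x y] d_less_iff[OF y z] by metis
  have "inv x \<otimes> z = (inv x \<otimes> y) \<otimes> (inv y \<otimes> z)"
    using x y z by (rule inv_mult_split)
  then have "inv x \<otimes> z \<in> prodV (ms @ ns)"
    unfolding prodV_append in_set_mult_iff using * by blast
  moreover have "wt (ms @ ns) < r"
    using *(1,3) by (simp add: e_def field_simps)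
  ultimately have "d x z < r" using d_less_iff[OF x z] by blast
  then show "d x z \<le> r" by simp
qed

sublocale Metric_space "carrier G" d
proof
  fix x y z
  show "0 \<le> d x y" by (rule d_nonneg)
  show "d x y = d y x"
  proof (cases "x \<in> carrier G \<and> y \<in> carrier G")
    case True
    then show ?thesis using d_commute_le by (intro order_antisym) auto
  qed (auto simp: chain_metric_def)
  show "d x z \<le> d x y + d y z" if "x \<in> carrier G" "y \<in> carrier G" "z \<in> carrier G"
    using d_triangle that by blast
  show "d x y = 0 \<longleftrightarrow> x = y" if x: "x \<in> carrier G" and y: "y \<in> carrier G"
  proof
    assume "x = y"
    then have *: "d x y < r" if "0 < r" for r
      using that d_less_iff[OF x y] x by (auto intro!: exI[of _ "[]"])
    show "d x y = 0"
      using d_nonneg[of x y] *[of "d x y"] by (cases "0 < d x y") auto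
  next
    assume "d x y = 0"
    then have V: "inv x \<otimes> y \<in> V n" for n
      using d_less_imp_V[OF x y, of n] by simp
    show "x = y"
    proof (rule ccontr)
      assume "x \<noteq> y"
      then obtain k where "x \<in> B k" "y \<notin> B k" using separated x y by blast
      then show False using B_contains_translate[of x k] V y by blast
    qed
  qed
qed

lemma openin_mtopology_iff: "openin mtopology U \<longleftrightarrow> (\<exists>S. U = (\<Union>i\<in>S. B i))"
proof
  assume U: "openin mtopology U"
  have "\<exists>k. x \<in> B k \<and> B k \<subseteq> U" if xU: "x \<in> U" for x
  proof -
    have x: "x \<in> carrier G" using U xU unfolding openin_mtopology by blast
    obtain r where r: "0 < r" "mball x r \<subseteq> U" using U xU unfolding openin_mtopology by blast
    then obtain n where n: "(1/2 :: real) ^ n < r" using real_arch_pow_inv[of r "1/2"] by auto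
    obtain k where k: "x \<in> B k" "\<forall>y\<in>B k. inv x \<otimes> y \<in> V n" using translate_contains_B[OF x] by blast
    have "B k \<subseteq> mball x r"
    proof
      fix y assume "y \<in> B k"
      then have "y \<in> carrier G" "d x y \<le> (1/2) ^ n"
        using B_carrier V_imp_d_le[OF x] k by blast+
      then show "y \<in> mball x r" using x n by simp
    qed
    then show ?thesis using k r by blast
  qed
  then have "U = (\<Union>i\<in>{k. B k \<subseteq> U}. B i)" by blast
  then show "\<exists>S. U = (\<Union>i\<in>S. B i)" ..
next
  assume "\<exists>S. U = (\<Union>i\<in>S. B i)"
  then obtain S where S: "U = (\<Union>i\<in>S. B i)" ..
  have "\<exists>r>0. mball x r \<subseteq> U" if xU: "x \<in> U" for x
  proof -
    obtain k where k: "x \<in> B k" "k \<in> S" using xU S by blast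
    obtain n where n: "\<forall>y\<in>carrier G. inv x \<otimes> y \<in> V n \<longrightarrow> y \<in> B k"
      using B_contains_translate[OF k(1)] by blast
    have "mball x ((1/2) ^ n) \<subseteq> B k"
      using n d_less_imp_V by auto
    then show ?thesis using S k by (intro exI[of _ "(1/2) ^ n"]) auto
  qed
  then show "openin mtopology U"
    unfolding openin_mtopology using S B_carrier by blast
qed

subsection \<open>Names of balls and dense points\<close>

text \<open>One factor \<open>V n\<close> put in front of a product \<open>P\<close>:
  \<open>z\<close> lies in \<open>V\<^sub>n P\<close> iff \<open>inv g \<otimes> z\<close> lies in
  \<open>P\<close> for some \<open>g\<close> in \<open>V n\<close>, and \<open>W i v w\<close>
  supplies \<open>g\<close> as a common point of \<open>B i\<close> and \<open>B v\<close>. Weights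
  are counted in multiples of \<open>(1/2) ^ N\<close>, whence the increment.\<close>

definition reach_step :: "nat \<Rightarrow> nat \<times> nat \<Rightarrow> nat \<times> nat \<Rightarrow> bool" where
  "reach_step N p p' \<longleftrightarrow> (\<exists>n v i w. n \<le> N \<and> NV n v \<and> D i (fst p') (fst p) \<and> W i v w \<and>
     snd p' = snd p + 2 ^ (N - n))"

text \<open>\<open>Reach N l k c\<close>: the set \<open>B\<^sub>k\<close> occurs in the name of a product of \<open>l + 1\<close> sets \<open>V\<^sub>n\<close> with
  \<open>n \<le> N\<close>, the last one being \<open>V\<^sub>N\<close>; the sum of the \<open>2\<^sup>-\<^sup>n\<close> is \<open>c / 2\<^sup>N\<close>.\<close>

definition Reach :: "nat \<Rightarrow> nat \<Rightarrow> nat \<Rightarrow> nat \<Rightarrow> bool" where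
  "Reach N l k c = rec_nat (\<lambda>p. NV N (fst p) \<and> snd p = 1)
     (\<lambda>m Q p'. \<exists>p. Q p \<and> reach_step N p p') l (k, c)"

lemma Reach_0: "Reach N 0 k c \<longleftrightarrow> NV N k \<and> c = 1"
  by (simp add: Reach_def)

lemma Reach_Suc: "Reach N (Suc l) k' c' \<longleftrightarrow> (\<exists>k c. Reach N l k c \<and> reach_step N (k, c) (k', c'))"
  by (simp add: Reach_def)

text \<open>Clearing denominators in \<open>c / 2 ^ N < a / b\<close> leaves a decidable comparison
  of natural numbers.\<close>

definition ratio_less :: "nat \<Rightarrow> nat \<Rightarrow> nat \<Rightarrow> bool" where
  "ratio_less k a b \<longleftrightarrow> (\<exists>N l c. Reach N l k c \<and> c * b < a * 2 ^ N)"

lemma semidec_ratio_less: "semidec (\<lambda>p. ratio_less (fst p) (fst (snd p)) (snd (snd p)))"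
proof -
  have *: "semidec (\<lambda>p. reach_step (fst p) (fst (snd (snd p))) (snd (snd (snd p))))"
    unfolding reach_step_def by (intro semidec_basic NV_intro D_intro W_intro)
  have Reach: "semidec (\<lambda>p. Reach (fst p) (fst (snd p)) (fst (snd (snd p))) (snd (snd (snd p))))"
    unfolding Reach_def
    by (rule semidec_iterate[where Q = "\<lambda>N p. NV N (fst p) \<and> snd p = 1" and
          S = "\<lambda>N _ p p'. reach_step N p p'"])
      (intro semidec_basic NV_intro semidec_comp3[OF *] *)+
  show ?thesis
    unfolding ratio_less_def by (intro semidec_basic semidec_comp4[OF Reach])
qed

lemmas ratio_less_intro = semidec_comp3[OF semidec_ratio_less]

lemma Reach:
  assumes "z \<in> carrier G"
  shows "(\<exists>k. z \<in> B k \<and> Reach N l k c) \<longleftrightarrow>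
    (\<exists>ns. length ns = l \<and> (\<forall>n\<in>set ns. n \<le> N) \<and> c = 1 + (\<Sum>n\<leftarrow>ns. 2 ^ (N - n)) \<and>
      z \<in> prodV (ns @ [N]))"
  using assms
proof (induction l arbitrary: z c)
  case 0
  have "prodV ([] @ [N]) = V N" by (simp only: append_Nil prodV_singleton)
  then show ?case using NV[OF 0, of N] by (auto simp add: Reach_0 simp del: prodV.simps)
next
  case (Suc l)
  show ?case
  proof
    assume "\<exists>k. z \<in> B k \<and> Reach N (Suc l) k c"
    then obtain k' k c' where k': "z \<in> B k'" "Reach N l k c'" "reach_step N (k, c') (k', c)"
      unfolding Reach_Suc by blast
    then obtain n v i w where *: "n \<le> N" "NV n v" "D i k' k" "W i v w" "c = c' + 2 ^ (N - n)"
      unfolding reach_step_def by auto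
    obtain g where g: "g \<in> B i" "g \<in> B v" using W_nonempty[OF *(4)] by blast
    then have car: "g \<in> carrier G" using B_carrier by blast
    have "g \<in> V n" using NV[OF car, of n] g *(2) by blast
    have gz: "inv g \<otimes> z \<in> carrier G" using car Suc.prems by simp
    have "inv g \<otimes> z \<in> B k" using D[OF car Suc.prems] g k'(1) *(3) by blast
    then obtain ns where ns: "length ns = l" "\<forall>n\<in>set ns. n \<le> N"
      "c' = 1 + (\<Sum>n\<leftarrow>ns. 2 ^ (N - n))" "inv g \<otimes> z \<in> prodV (ns @ [N])"
      using Suc.IH[OF gz, of c'] k'(2) by blast
    have "z \<in> V n <#> prodV (ns @ [N])"
      unfolding in_set_mult_iff using \<open>g \<in> V n\<close> ns(4) mult_inv_mult_cancel[OF car Suc.prems] by force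
    then show "\<exists>ns. length ns = Suc l \<and> (\<forall>n\<in>set ns. n \<le> N) \<and> c = 1 + (\<Sum>n\<leftarrow>ns. 2 ^ (N - n)) \<and>
        z \<in> prodV (ns @ [N])"
      using ns * by (intro exI[of _ "n # ns"]) auto
  next
    assume "\<exists>ns. length ns = Suc l \<and> (\<forall>n\<in>set ns. n \<le> N) \<and> c = 1 + (\<Sum>n\<leftarrow>ns. 2 ^ (N - n)) \<and>
        z \<in> prodV (ns @ [N])"
    then obtain n ns where ns: "length ns = l" "n \<le> N" "\<forall>n\<in>set ns. n \<le> N"
      "c = 1 + (\<Sum>n\<leftarrow>ns. 2 ^ (N - n)) + 2 ^ (N - n)" "z \<in> V n <#> prodV (ns @ [N])"
      by (auto simp: length_Suc_conv)
    then obtain g h where gh: "z = g \<otimes> h" "g \<in> V n" "h \<in> prodV (ns @ [N])"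
      by (auto simp: in_set_mult_iff[of z])
    then have car: "g \<in> carrier G" "h \<in> carrier G"
      using V_carrier prodV_carrier by blast+
    then obtain k where k: "h \<in> B k" "Reach N l k (1 + (\<Sum>n\<leftarrow>ns. 2 ^ (N - n)))"
      using Suc.IH[OF car(2)] ns gh(3) by blast
    have "inv g \<otimes> z = h" using gh car by (simp flip: m_assoc)
    then obtain i k' where ik: "g \<in> B i" "z \<in> B k'" "D i k' k"
      using D[OF car(1) Suc.prems, of k] k(1) by auto
    obtain v where v: "g \<in> B v" "NV n v" using NV[OF car(1), of n] gh(2) by blast
    obtain w where "W i v w" using W ik(1) v(1) by blast
    then have "reach_step N (k, 1 + (\<Sum>n\<leftarrow>ns. 2 ^ (N - n))) (k', c)"
      unfolding reach_step_def using ns(2,4) v ik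
      by (intro exI[of _ n] exI[of _ v] exI[of _ i] exI[of _ w]) simp
    then show "\<exists>k. z \<in> B k \<and> Reach N (Suc l) k c"
      unfolding Reach_Suc using k ik by blast
  qed
qed

lemma wt_eq_ratio:
  "(\<forall>n\<in>set ns. n \<le> N) \<Longrightarrow> wt (ns @ [N]) = real (1 + (\<Sum>n\<leftarrow>ns. 2 ^ (N - n))) / 2 ^ N"
proof (induction ns)
  case (Cons n ns)
  have "(1/2 :: real) ^ n = 2 ^ (N - n) / 2 ^ N"
    using Cons.prems by (simp add: power_diff power_one_over field_simps)
  then show ?case using Cons by (simp add: add_divide_distrib)
qed (simp add: power_one_over)

text \<open>The empty product \<open>{\<one>}\<close> need not be open, so it may have no name. A
  last factor \<open>V N\<close> repairs this: the strict inequality leaves room for its weight, and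
  the identity in \<open>V N\<close> keeps the old product inside the new one.\<close>

lemma d_less_ratio:
  assumes x: "x \<in> carrier G" and y: "y \<in> carrier G" and b: "0 < b"
  shows "d x y < real a / real b \<longleftrightarrow> (\<exists>k. inv x \<otimes> y \<in> B k \<and> ratio_less k a b)"
proof
  have xy: "inv x \<otimes> y \<in> carrier G" using x y by simp
  have ratio: "real c / 2 ^ N < real a / real b \<longleftrightarrow> c * b < a * 2 ^ N" for c N
  proof -
    have "real c / 2 ^ N < real a / real b \<longleftrightarrow> real (c * b) < real (a * 2 ^ N)"
      using b by (simp add: field_simps)
    then show ?thesis by (simp only: of_nat_less_iff)
  qed
  {
    assume "d x y < real a / real b"
    then obtain ns where ns: "wt ns < real a / real b" "inv x \<otimes> y \<in> prodV ns"
      using d_less_iff[OF x y] by blast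
    \<comment> \<open>\<open>N0\<close> makes the extra factor fit into the gap. \<open>N\<close>
      also bounds all entries of \<open>ns\<close>, so that \<open>2 ^ N\<close> is a common
      denominator.\<close>
    obtain N0 where N0: "(1/2 :: real) ^ N0 < real a / real b - wt ns"
      using ns(1) real_arch_pow_inv[of "real a / real b - wt ns" "1/2"] by auto
    define N where "N = Max (insert N0 (set ns))"
    have N: "N0 \<le> N" "\<forall>n\<in>set ns. n \<le> N" unfolding N_def by auto
    have "(1/2 :: real) ^ N \<le> (1/2) ^ N0" using N(1) by (intro power_decreasing) auto
    moreover have "wt (ns @ [N]) = wt ns + (1/2) ^ N" by simp
    ultimately have "wt (ns @ [N]) < real a / real b" using N0 by linarith
    then have c: "(1 + (\<Sum>n\<leftarrow>ns. 2 ^ (N - n))) * b < a * 2 ^ N"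
      unfolding wt_eq_ratio[OF N(2)] ratio .
    have "inv x \<otimes> y \<in> prodV ns <#> V N"
      unfolding in_set_mult_iff using ns(2) one_V[of N] xy by (metis r_one)
    then have "inv x \<otimes> y \<in> prodV (ns @ [N])"
      by (simp only: prodV_append prodV_singleton)
    then obtain k where "inv x \<otimes> y \<in> B k" "Reach N (length ns) k (1 + (\<Sum>n\<leftarrow>ns. 2 ^ (N - n)))"
      using Reach[OF xy] N(2) by blast
    then show "\<exists>k. inv x \<otimes> y \<in> B k \<and> ratio_less k a b"
      unfolding ratio_less_def using c by blast
  next
    assume "\<exists>k. inv x \<otimes> y \<in> B k \<and> ratio_less k a b"
    then obtain k N l c where k: "inv x \<otimes> y \<in> B k" "Reach N l k c" "c * b < a * 2 ^ N"
      unfolding ratio_less_def by blast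
    then obtain ns where ns: "\<forall>n\<in>set ns. n \<le> N" "c = 1 + (\<Sum>n\<leftarrow>ns. 2 ^ (N - n))"
      "inv x \<otimes> y \<in> prodV (ns @ [N])"
      using Reach[OF xy] by blast
    have "wt (ns @ [N]) < real a / real b"
      using wt_eq_ratio[OF ns(1)] ns(2) ratio[of c N] k(3) by simp
    then show "d x y < real a / real b" using d_less_iff[OF x y] ns(3) by blast
  }
qed

section \<open>Points as limits of shrinking basic sets\<close>

definition small where
  "small n j j' \<longleftrightarrow> (\<exists>k a c w. NV n k \<and> D a c k \<and> W a c w \<and> W w j j')"

lemma semidec_small: "semidec (\<lambda>p. small (fst (fst p)) (snd (fst p)) (snd p))"
  unfolding small_def by (intro semidec_basic NV_intro D_intro W_intro)

lemma small_subset: "small n j j' \<Longrightarrow> B j' \<subseteq> B j"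
  unfolding small_def using W by blast

text \<open>\<open>D a c k\<close> ensures that quotients of points of \<open>B a\<close> and
  \<open>B c\<close> fall into \<open>B k\<close>, which is part of the name of \<open>V n\<close>;
  the two conditions on \<open>W\<close> place \<open>B j'\<close> inside both \<open>B a\<close>
  and \<open>B c\<close>.\<close>

lemma small_diff:
  assumes "small n j j'" "x \<in> B j'" "y \<in> B j'"
  shows "inv x \<otimes> y \<in> V n"
proof -
  obtain k a c w where *: "NV n k" "D a c k" "W a c w" "W w j j'"
    using assms(1) unfolding small_def by blast
  then have xy: "x \<in> B a" "y \<in> B c" using assms(2,3) W by blast+
  then have car: "x \<in> carrier G" "y \<in> carrier G" using B_carrier by blast+
  then have "inv x \<otimes> y \<in> B k" using D[OF car] * xy by blast
  then show ?thesis using NV[of "inv x \<otimes> y" n] *(1) car by auto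
qed

lemma ex_small: "\<exists>j'. small n j j'"
proof -
  obtain x where x: "x \<in> B j" using B_nonempty by blast
  then have car: "x \<in> carrier G" using B_carrier by blast
  obtain k where k: "\<one> \<in> B k" "NV n k" using NV[of \<one> n] one_V by auto
  then have "inv x \<otimes> x \<in> B k" using car by simp
  then obtain a c where ac: "x \<in> B a" "x \<in> B c" "D a c k" using D[OF car car] by blast
  obtain w where w: "x \<in> B w" "W a c w" using W ac by blast
  obtain j' where "W w j j'" using W w x by blast
  then show ?thesis unfolding small_def using k ac w by blast
qed

definition refine :: "nat \<times> nat \<Rightarrow> nat" where
  "refine = (SOME f. computable f \<and> (\<forall>p. small (fst p) (snd p) (f p)))"

lemma computable_refine: "computable refine"
  and small_refine: "small n j (refine (n, j))"
proof -
  obtain f where "computable f" "\<And>p. small (fst p) (snd p) (f p)"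
    using semidec_select[OF semidec_small] ex_small by metis
  then have "\<exists>f. computable f \<and> (\<forall>p. small (fst p) (snd p) (f p))" by blast
  from someI_ex[OF this] have *: "computable refine \<and> (\<forall>p. small (fst p) (snd p) (refine p))"
    unfolding refine_def .
  then show "computable refine" by blast
  show "small n j (refine (n, j))" using * by (metis fst_conv snd_conv)
qed

text \<open>The point with index \<open>(j, n)\<close> is the limit of shrinking basic sets inside \<open>B\<^sub>j\<close>, starting
  at radius \<open>2\<^sup>-\<^sup>n\<close>. It may fall outside \<open>B\<^sub>j\<close>, so \<open>n\<close> is needed for density.\<close>

definition nest :: "nat \<Rightarrow> nat \<Rightarrow> nat" where
  "nest i l = rec_nat (fst (prod_decode i)) (\<lambda>l j. refine (l + snd (prod_decode i), j)) l"

lemma computable_nest: "computable (\<lambda>p. nest (fst p) (snd p))"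
  unfolding nest_def by (intro computable_rec computable_basic computable_comp[OF computable_refine])

lemma nest_0: "nest i 0 = fst (prod_decode i)"
  by (simp add: nest_def)

lemma small_nest: "small (l + snd (prod_decode i)) (nest i l) (nest i (Suc l))"
  by (simp add: nest_def small_refine)

lemma nest_antimono: "l \<le> m \<Longrightarrow> B (nest i m) \<subseteq> B (nest i l)"
  by (rule lift_Suc_antimono_le[of "\<lambda>l. B (nest i l)"]) (use small_subset[OF small_nest] in auto)

lemma nest_d_le:
  assumes "y \<in> B (nest i (Suc l))" "z \<in> B (nest i (Suc l))"
  shows "d y z \<le> (1/2) ^ (l + snd (prod_decode i))"
  by (rule V_imp_d_le[OF B_carrier[OF assms(1)] B_carrier[OF assms(2)] small_diff[OF small_nest assms]])

end

locale complete_computable_group = computable_group_search +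
  assumes complete: "mcomplete"
begin

text \<open>Only the indices \<open>nest i l\<close> are computed. The points
  \<open>\<sigma> l\<close> are chosen without any effectivity, because all choices converge to the
  same limit. The successor appears because the diameter of the initial set
  \<open>B (nest i 0)\<close> is not controlled.\<close>

lemma ex_limit:
  "\<exists>x\<in>carrier G. \<forall>l. \<forall>y\<in>B (nest i (Suc l)). d y x \<le> (1/2) ^ (l + snd (prod_decode i))"
proof -
  let ?n = "snd (prod_decode i)"
  have "\<forall>l. \<exists>y. y \<in> B (nest i (Suc l))" using B_nonempty by blast
  then obtain \<sigma> where \<sigma>: "\<And>l. \<sigma> l \<in> B (nest i (Suc l))" by metis
  then have \<sigma>_carrier: "\<sigma> l \<in> carrier G" for l using B_carrier by blast
  have \<sigma>_mem: "\<sigma> m \<in> B (nest i (Suc l))" if "l \<le> m" for l m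
    using \<sigma>[of m] nest_antimono[of "Suc l" "Suc m" i] that by auto
  have "MCauchy \<sigma>"
    unfolding MCauchy_def
  proof (intro conjI allI impI)
    fix e :: real assume "0 < e"
    then obtain N where N: "(1/2 :: real) ^ N < e" using real_arch_pow_inv[of e "1/2"] by auto
    have "d (\<sigma> m) (\<sigma> n) < e" if "N \<le> m" "N \<le> n" for m n
    proof -
      have "d (\<sigma> m) (\<sigma> n) \<le> (1/2) ^ (N + ?n)"
        by (intro nest_d_le \<sigma>_mem that)
      also have "\<dots> \<le> (1/2) ^ N" by (rule power_decreasing) auto
      finally show ?thesis using N by simp
    qed
    then show "\<exists>N. \<forall>n n'. N \<le> n \<longrightarrow> N \<le> n' \<longrightarrow> d (\<sigma> n) (\<sigma> n') < e" by blast
  qed (use \<sigma>_carrier in auto)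
  then obtain x where x: "limitin mtopology \<sigma> x sequentially"
    using complete unfolding mcomplete_def by blast
  then have car: "x \<in> carrier G" using limit_metric_sequentially by blast
  have "d y x \<le> (1/2) ^ (l + ?n)" if y: "y \<in> B (nest i (Suc l))" for l y
  proof (rule field_le_epsilon)
    fix e :: real assume "0 < e"
    then obtain N where N: "\<forall>n\<ge>N. d (\<sigma> n) x < e"
      using x unfolding limit_metric_sequentially by blast
    have "d y x \<le> d y (\<sigma> (max l N)) + d (\<sigma> (max l N)) x"
      by (intro triangle \<sigma>_carrier car) (use y B_carrier in blast)
    moreover have "d y (\<sigma> (max l N)) \<le> (1/2) ^ (l + ?n)"
      by (intro nest_d_le y \<sigma>_mem) simp
    ultimately show "d y x \<le> (1/2) ^ (l + ?n) + e"
      using N by (smt (verit) max.cobounded2)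
  qed
  then show ?thesis using car by blast
qed

definition pt :: "nat \<Rightarrow> 'a" where
  "pt i = (SOME x. x \<in> carrier G \<and>
     (\<forall>l. \<forall>y\<in>B (nest i (Suc l)). d y x \<le> (1/2) ^ (l + snd (prod_decode i))))"

lemma pt_carrier: "pt i \<in> carrier G"
  and pt_d_le: "y \<in> B (nest i (Suc l)) \<Longrightarrow> d y (pt i) \<le> (1/2) ^ (l + snd (prod_decode i))"
proof -
  have "\<exists>x. x \<in> carrier G \<and>
     (\<forall>l. \<forall>y\<in>B (nest i (Suc l)). d y x \<le> (1/2) ^ (l + snd (prod_decode i)))"
    using ex_limit[of i] by blast
  from someI_ex[OF this] have *: "pt i \<in> carrier G \<and>
     (\<forall>l. \<forall>y\<in>B (nest i (Suc l)). d y (pt i) \<le> (1/2) ^ (l + snd (prod_decode i)))"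
    unfolding pt_def .
  show "pt i \<in> carrier G" using * by blast
  show "y \<in> B (nest i (Suc l)) \<Longrightarrow> d y (pt i) \<le> (1/2) ^ (l + snd (prod_decode i))"
    using * by blast
qed

lemma pt_dense:
  assumes x: "x \<in> carrier G"
  shows "\<exists>i. d (pt i) x < (1/2) ^ n"
proof -
  \<comment> \<open>Two errors of at most \<open>(1/2) ^ ?m\<close> add up, from \<open>x\<close> to
    \<open>y\<close> inside \<open>B j\<close> and from \<open>y\<close> to the limit; their sum is
    half of \<open>(1/2) ^ n\<close>.\<close>
  let ?m = "Suc (Suc n)"
  obtain j where j: "x \<in> B j" "\<forall>y\<in>B j. inv x \<otimes> y \<in> V ?m" using translate_contains_B[OF x] by blast
  define i where "i = prod_encode (j, ?m)"
  obtain y where y: "y \<in> B (nest i (Suc 0))" using B_nonempty by blast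
  then have "y \<in> B j" using nest_antimono[of 0 "Suc 0" i] by (auto simp: nest_0 i_def)
  then have y_car: "y \<in> carrier G" using B_carrier by blast
  have "d x y \<le> (1/2) ^ ?m" using j \<open>y \<in> B j\<close> V_imp_d_le[OF x y_car] by blast
  moreover have "d y (pt i) \<le> (1/2) ^ ?m" using pt_d_le[OF y] by (simp add: i_def)
  moreover have "d x (pt i) \<le> d x y + d y (pt i)" by (rule triangle[OF x y_car pt_carrier])
  ultimately have "d x (pt i) \<le> (1/2) ^ ?m + (1/2) ^ ?m" by linarith
  also have "\<dots> < (1/2) ^ n" by simp
  finally show ?thesis using commute by metis
qed

lemma pt_in_B_iff:
  "pt i \<in> B k \<longleftrightarrow> (\<exists>a m l w. A a m k \<and> Suc m < l \<and> W (nest i (Suc l)) a w)"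
proof
  assume "pt i \<in> B k"
  then obtain a m where a: "A a m k" "pt i \<in> B a" using ex_A by blast
  obtain n where n: "\<forall>y\<in>carrier G. inv (pt i) \<otimes> y \<in> V n \<longrightarrow> y \<in> B a"
    using B_contains_translate[OF a(2)] by blast
  \<comment> \<open>\<open>l\<close> exceeds \<open>n\<close>, so that points of the approximating
    set lie in \<open>B a\<close>, and it exceeds \<open>Suc m\<close>, as the test demands.\<close>
  define l where "l = Suc (Suc (m + n))"
  obtain y where y: "y \<in> B (nest i (Suc l))" using B_nonempty by blast
  then have y_car: "y \<in> carrier G" using B_carrier by blast
  have "d (pt i) y \<le> (1/2) ^ (l + snd (prod_decode i))" using pt_d_le[OF y] commute by metis
  also have "\<dots> < (1/2) ^ n" by (rule power_strict_decreasing) (auto simp: l_def)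
  finally have "y \<in> B a" using n y_car d_less_imp_V[OF pt_carrier y_car] by blast
  then obtain w where "W (nest i (Suc l)) a w" using W y by blast
  then show "\<exists>a m l w. A a m k \<and> Suc m < l \<and> W (nest i (Suc l)) a w"
    using a(1) by (intro exI[of _ a] exI[of _ m] exI[of _ l] exI[of _ w]) (simp add: l_def)
next
  assume "\<exists>a m l w. A a m k \<and> Suc m < l \<and> W (nest i (Suc l)) a w"
  then obtain a m l w where *: "A a m k" "Suc m < l" "W (nest i (Suc l)) a w" by blast
  then obtain y where y: "y \<in> B (nest i (Suc l))" "y \<in> B a" using W_nonempty by blast
  then have y_car: "y \<in> carrier G" using B_carrier by blast
  have "d y (pt i) \<le> (1/2) ^ (l + snd (prod_decode i))" using pt_d_le[OF y(1)] .
  \<comment> \<open>The estimate for the limit is non-strict, while \<open>d_less_imp_V\<close> asks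
    for a strict one; hence \<open>Suc m < l\<close> in the test.\<close>
  also have "\<dots> < (1/2) ^ Suc m" by (rule power_strict_decreasing) (use *(2) in auto)
  finally have "inv y \<otimes> pt i \<in> V (Suc m)" using d_less_imp_V[OF y_car pt_carrier] by blast
  then show "pt i \<in> B k" using V_translate_subset_B[OF *(1) y(2) lessI _ pt_carrier] by blast
qed

lemma semidec_pt: "semidec (\<lambda>p. pt (fst p) \<in> B (snd p))"
  unfolding pt_in_B_iff
  by (intro semidec_basic A_intro W_intro computable_comp2[OF computable_nest])

lemmas pt_intro = semidec_comp2[OF semidec_pt]

section \<open>Translation between the balls and the given base\<close>

definition ball_name where
  "ball_name k c \<longleftrightarrow> (\<exists>a t. D a k t \<and> pt (fst (prod_decode c)) \<in> B a \<and>
     ratio_less t (Suc (fst (prod_decode (snd (prod_decode c)))))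
       (Suc (snd (prod_decode (snd (prod_decode c))))))"

lemma semidec_ball_name: "semidec (\<lambda>p. ball_name (fst p) (snd p))"
  unfolding ball_name_def by (intro semidec_basic D_intro pt_intro ratio_less_intro)

abbreviation "C \<equiv> ball_base (carrier G) d pt"

lemma in_C_iff: "y \<in> C c \<longleftrightarrow> y \<in> carrier G \<and> d (pt (fst (prod_decode c))) y < pos_rat (snd (prod_decode c))"
  by (simp add: ball_base_def split_def pt_carrier)

lemma pos_rat_eq: "pos_rat q = real (Suc (fst (prod_decode q))) / real (Suc (snd (prod_decode q)))"
  by (simp add: pos_rat_def split_def)

text \<open>The centre is known through the sets \<open>B a\<close> that contain it, and
  \<open>y\<close> through \<open>B k\<close>. \<open>D a k t\<close> carries both to a set
  \<open>B t\<close> around their quotient, on which \<open>ratio_less\<close> verifies the bound.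
  The successors in \<open>ball_name\<close> are those of \<open>pos_rat\<close>.\<close>

lemma ball_name: "y \<in> C c \<longleftrightarrow> (\<exists>k. y \<in> B k \<and> ball_name k c)"
proof (cases "y \<in> carrier G")
  case True
  then have "y \<in> C c \<longleftrightarrow> d (pt (fst (prod_decode c))) y
      < real (Suc (fst (prod_decode (snd (prod_decode c)))))
        / real (Suc (snd (prod_decode (snd (prod_decode c)))))"
    unfolding in_C_iff pos_rat_eq by blast
  then show ?thesis
    unfolding ball_name_def d_less_ratio[OF pt_carrier True zero_less_Suc] D[OF pt_carrier True]
    by blast
qed (auto simp: in_C_iff B_carrier)

text \<open>A ball of radius at most \<open>(1/2) ^ Suc m\<close> about \<open>x\<close> lies in the
  translate of \<open>V (Suc m)\<close> by \<open>x\<close>, hence in \<open>B k\<close> if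
  \<open>x\<close> is in \<open>B a\<close> and \<open>A a m k\<close> holds. The last conjunct is
  this bound on the radius with denominators cleared.\<close>

definition B_name where
  "B_name c k \<longleftrightarrow> (\<exists>a m. A a m k \<and> pt (fst (prod_decode c)) \<in> B a \<and>
     Suc (fst (prod_decode (snd (prod_decode c)))) * 2 ^ Suc m
       \<le> Suc (snd (prod_decode (snd (prod_decode c)))))"

lemma semidec_B_name: "semidec (\<lambda>p. B_name (fst p) (snd p))"
  unfolding B_name_def by (intro semidec_basic A_intro pt_intro)

lemma B_name: "y \<in> B k \<longleftrightarrow> (\<exists>c. y \<in> C c \<and> B_name c k)"
proof
  assume y: "y \<in> B k"
  then have y_car: "y \<in> carrier G" using B_carrier by blast
  obtain a m where a: "A a m k" "y \<in> B a" using ex_A y by blast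
  obtain n where n: "\<forall>z\<in>carrier G. inv y \<otimes> z \<in> V n \<longrightarrow> z \<in> B a"
    using B_contains_translate[OF a(2)] by blast
  \<comment> \<open>Precision \<open>n\<close> brings the centre into \<open>B a\<close>; precision
    \<open>Suc m\<close> brings \<open>y\<close> into a ball that \<open>B_name\<close>
    accepts.\<close>
  obtain i where i: "d (pt i) y < (1/2) ^ (n + Suc m)" using pt_dense[OF y_car] by blast
  have "(1/2 :: real) ^ (n + Suc m) \<le> (1/2) ^ n" "(1/2 :: real) ^ (n + Suc m) \<le> (1/2) ^ Suc m"
    by (rule power_decreasing; simp)+
  then have d_n: "d y (pt i) < (1/2) ^ n" and d_m: "d (pt i) y < (1/2) ^ Suc m"
    using i commute[of y "pt i"] by linarith+
  have "pt i \<in> B a" using n pt_carrier d_less_imp_V[OF y_car pt_carrier d_n] by blast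
  \<comment> \<open>\<open>pos_rat\<close> adds one to both components, so the radius coded here is
    \<open>1 / 2 ^ Suc m\<close>.\<close>
  define c where "c = prod_encode (i, prod_encode (0, 2 ^ Suc m - 1))"
  have "pos_rat (snd (prod_decode c)) = (1/2) ^ Suc m"
    by (simp add: pos_rat_eq c_def of_nat_diff power_one_over)
  then have "y \<in> C c" using y_car d_m by (simp add: in_C_iff c_def)
  moreover have "B_name c k"
    unfolding B_name_def using a(1) \<open>pt i \<in> B a\<close> by (intro exI[of _ a] exI[of _ m]) (simp add: c_def)
  ultimately show "\<exists>c. y \<in> C c \<and> B_name c k" by blast
next
  assume "\<exists>c. y \<in> C c \<and> B_name c k"
  then obtain c a m where c: "y \<in> C c" "A a m k" "pt (fst (prod_decode c)) \<in> B a"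
    "Suc (fst (prod_decode (snd (prod_decode c)))) * 2 ^ Suc m
       \<le> Suc (snd (prod_decode (snd (prod_decode c))))"
    unfolding B_name_def by blast
  have "real (Suc (fst (prod_decode (snd (prod_decode c)))) * 2 ^ Suc m)
       \<le> real (Suc (snd (prod_decode (snd (prod_decode c)))))"
    using c(4) by (simp only: of_nat_le_iff)
  then have "pos_rat (snd (prod_decode c)) \<le> (1/2) ^ Suc m"
    unfolding pos_rat_eq power_one_over by (simp add: field_simps)
  then have y: "y \<in> carrier G" "d (pt (fst (prod_decode c))) y < (1/2) ^ Suc m"
    using c(1) unfolding in_C_iff by auto
  then have "inv (pt (fst (prod_decode c))) \<otimes> y \<in> V (Suc m)"
    using d_less_imp_V[OF pt_carrier] by blast
  then show "y \<in> B k" using V_translate_subset_B[OF c(2,3) lessI _ y(1)] by blast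
qed

end

section \<open>Presentations\<close>

text \<open>\<open>int_decode\<close> sends even \<open>n\<close> to \<open>n / 2\<close> and odd
  \<open>n\<close> to \<open>- (n + 1) / 2\<close>, so equal parities mean a non-negative quotient.
  Parity is written with subtraction and halving to match the computability rules. A zero
  denominator gives the rational \<open>0\<close>, which exceeds no
  \<open>t \<ge> 0\<close>.\<close>

lemma of_rat_nat_to_rat_surj_greater_iff:
  fixes t :: real
  assumes "0 \<le> t"
  defines "a \<equiv> \<lambda>q. fst (prod_decode q)" and "b \<equiv> \<lambda>q. snd (prod_decode q)"
  shows "t < of_rat (nat_to_rat_surj q) \<longleftrightarrow>
    a q - (a q div 2 + a q div 2) = b q - (b q div 2 + b q div 2) \<and> 0 < Suc (b q) div 2 \<and>
    t < real (Suc (a q) div 2) / real (Suc (b q) div 2)"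
proof -
  have int_decode: "int_decode n = (if even n then 1 else - 1) * int (Suc n div 2)" for n
    by (auto simp: int_decode_def sum_decode_def)
  have frac: "real_of_int ((if P then 1 else - 1) * int n) / real_of_int ((if Q then 1 else - 1) * int m) =
      (if P \<longleftrightarrow> Q then 1 else - 1) * (real n / real m)" for P Q n m
    by (cases P; cases Q) simp_all
  have parity: "n - (n div 2 + n div 2) = m - (m div 2 + m div 2) \<longleftrightarrow> (even n \<longleftrightarrow> even m)" for n m :: nat
    by presburger
  have "of_rat (nat_to_rat_surj q) = real_of_int (int_decode (a q)) / real_of_int (int_decode (b q))"
    unfolding nat_to_rat_surj_def a_def b_def
    by (simp add: Let_def split_def Fract_of_int_quotient of_rat_divide)
  also have "\<dots> = (if even (a q) \<longleftrightarrow> even (b q) then 1 else - 1) *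
      (real (Suc (a q) div 2) / real (Suc (b q) div 2))"
    unfolding int_decode frac ..
  finally have *: "of_rat (nat_to_rat_surj q) = (if even (a q) \<longleftrightarrow> even (b q) then 1 else - 1) *
      (real (Suc (a q) div 2) / real (Suc (b q) div 2))" .
  show ?thesis
  proof (cases "even (a q) \<longleftrightarrow> even (b q)")
    case True
    then show ?thesis
      unfolding * parity using assms(1) by (cases "Suc (b q) div 2 = 0") simp_all
  next
    case False
    have "0 \<le> real (Suc (a q) div 2) / real (Suc (b q) div 2)" by simp
    then have "\<not> t < - 1 * (real (Suc (a q) div 2) / real (Suc (b q) div 2))"
      using assms(1) by linarith
    then show ?thesis unfolding * parity using False by simp
  qed
qed

text \<open>A preimage commutes with unions, so an enumeration operator for a continuous map is
  determined by its values on singleton names.\<close>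

lemma effectively_continuousI:
  assumes f: "f \<in> topspace X \<rightarrow> topspace Y"
    and Q: "semidec (\<lambda>p. Q (fst p) (snd p))"
    and iff: "\<And>x k. x \<in> topspace X \<and> f x \<in> BY k \<longleftrightarrow> (\<exists>n. x \<in> BX n \<and> Q n k)"
  shows "effectively_continuous X BX Y BY f"
proof -
  \<comment> \<open>\<open>2 ^ k\<close> is the canonical index of \<open>{k}\<close>.\<close>
  define E :: "(nat \<times> nat) set" where "E = {(n, u). \<exists>k. u = 2 ^ k \<and> Q n k}"
  have "semidec (\<lambda>p. (fst p, snd p) \<in> E)"
    unfolding E_def mem_Collect_eq split by (intro semidec_basic semidec_comp2[OF Q])
  then have "ce_axioms E"
    unfolding ce_axioms_def by (subst ce2_iff)
  moreover have "is_name BX (enum_op E S) {x \<in> topspace X. f x \<in> V}" if "is_name BY S V" for V S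
  proof -
    have "set_decode (2 ^ k) = {k}" for k
      using set_encode_inverse[of "{k}"] by simp
    then have "enum_op E S = {n. \<exists>k\<in>S. Q n k}"
      unfolding enum_op_def E_def by auto
    moreover have "{x \<in> topspace X. f x \<in> V} = (\<Union>k\<in>S. {x. x \<in> topspace X \<and> f x \<in> BY k})"
      using that unfolding is_name_def by blast
    ultimately show ?thesis
      unfolding is_name_def iff by blast
  qed
  ultimately show ?thesis
    unfolding effectively_continuous_def using f by blast
qed

text \<open>Feeding the operator the name \<open>{k}\<close> of \<open>BY k\<close> recovers a
  relation on indices. The axioms that can fire have the finite set \<open>{}\<close> or
  \<open>{k}\<close>, with canonical indices \<open>0\<close> and \<open>2 ^ k\<close>.\<close>

lemma effectively_continuousD:
  assumes "effectively_continuous X BX Y BY f" and BY: "\<And>k. openin Y (BY k)"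
  shows "\<exists>Q. semidec (\<lambda>p. Q (fst p) (snd p)) \<and>
    (\<forall>x k. x \<in> topspace X \<and> f x \<in> BY k \<longleftrightarrow> (\<exists>n. x \<in> BX n \<and> Q n k))"
proof -
  obtain E where E: "ce_axioms E" "\<And>V S. openin Y V \<Longrightarrow> is_name BY S V \<Longrightarrow>
      is_name BX (enum_op E S) {x \<in> topspace X. f x \<in> V}"
    using assms(1) unfolding effectively_continuous_def by blast
  have semidec_E: "semidec (\<lambda>p. (fst p, snd p) \<in> E)"
    using E(1) unfolding ce_axioms_def by (subst (asm) ce2_iff)
  define Q where "Q n k \<longleftrightarrow> (n, 0) \<in> E \<or> (n, 2 ^ k) \<in> E" for n k
  have "set_decode u \<subseteq> {k} \<longleftrightarrow> u = 0 \<or> u = 2 ^ k" for u k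
  proof
    assume "set_decode u \<subseteq> {k}"
    then have "set_decode u = {} \<or> set_decode u = {k}" by blast
    then have "u = set_encode {} \<or> u = set_encode {k}" by (metis set_decode_inverse)
    then show "u = 0 \<or> u = 2 ^ k" by simp
  next
    assume "u = 0 \<or> u = 2 ^ k"
    then show "set_decode u \<subseteq> {k}"
    proof
      assume u: "u = 2 ^ k"
      have "set_decode (2 ^ k) = {k}"
        using set_encode_inverse[of "{k}"] by simp
      then show ?thesis by (simp only: u)
    qed simp
  qed
  then have "enum_op E {k} = {n. Q n k}" for k
    unfolding enum_op_def Q_def by auto
  then have *: "{x \<in> topspace X. f x \<in> BY k} = (\<Union>n\<in>{n. Q n k}. BX n)" for k
    using E(2)[OF BY, of "{k}" k] by (simp add: is_name_def)
  have "semidec (\<lambda>p. Q (fst p) (snd p))"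
    unfolding Q_def
    by (intro semidec_basic semidec_comp2[where R = "\<lambda>n u. (n, u) \<in> E", OF semidec_E])
  moreover have "x \<in> topspace X \<and> f x \<in> BY k \<longleftrightarrow> (\<exists>n. x \<in> BX n \<and> Q n k)" for x k
    using *[of k] by blast
  ultimately show ?thesis by (intro exI[of _ Q]) blast
qed

section \<open>Change of base\<close>

lemma effectively_continuous_change_base:
  assumes f: "effectively_continuous X BX Y BY f" and BY: "\<And>k. openin Y (BY k)"
    and P: "semidec (\<lambda>p. P (fst p) (snd p))" "\<And>y c. y \<in> CY c \<longleftrightarrow> (\<exists>k. y \<in> BY k \<and> P k c)"
    and Q: "semidec (\<lambda>p. Q (fst p) (snd p))" "\<And>x k. x \<in> BX k \<longleftrightarrow> (\<exists>c. x \<in> CX c \<and> Q c k)"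
  shows "effectively_continuous X CX Y CY f"
proof -
  obtain R where R: "semidec (\<lambda>p. R (fst p) (snd p))"
    "\<And>x k. x \<in> topspace X \<and> f x \<in> BY k \<longleftrightarrow> (\<exists>n. x \<in> BX n \<and> R n k)"
    using effectively_continuousD[OF f BY] by blast
  show ?thesis
  proof (rule effectively_continuousI)
    show "f \<in> topspace X \<rightarrow> topspace Y"
      using f unfolding effectively_continuous_def by blast
    show "semidec (\<lambda>p. \<exists>n k. Q (fst p) n \<and> R n k \<and> P k (snd p))"
      by (intro semidec_basic semidec_comp2[OF P(1)] semidec_comp2[OF Q(1)] semidec_comp2[OF R(1)])
    show "x \<in> topspace X \<and> f x \<in> CY c \<longleftrightarrow> (\<exists>n. x \<in> CX n \<and> (\<exists>m k. Q n m \<and> R m k \<and> P k c))" for x c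
    proof -
      have "x \<in> topspace X \<and> f x \<in> CY c \<longleftrightarrow> (\<exists>k. (x \<in> topspace X \<and> f x \<in> BY k) \<and> P k c)"
        unfolding P(2) by blast
      then show ?thesis
        unfolding R(2) Q(2) by blast
    qed
  qed
qed

lemma in_prod_base_iff:
  "x \<in> prod_base B C n \<longleftrightarrow> fst x \<in> B (fst (prod_decode n)) \<and> snd x \<in> C (snd (prod_decode n))"
  by (auto simp: prod_base_def split_def mem_Times_iff)

lemma computable_topological_group_openin_base:
  "computable_topological_group G T B \<Longrightarrow> openin T (B k)"
  unfolding computable_topological_group_def computable_topological_space_def is_name_def
  by (metis UN_insert UN_empty Un_empty_right)

text \<open>Bases that name each other uniformly carry the same computable structure: an index
  relation for the new base passes to the old one by \<open>P\<close>, through the old relation, and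
  back by \<open>Q\<close>. This installs the balls as a base of the unchanged group.\<close>

lemma computable_topological_group_change_base:
  assumes G: "computable_topological_group G T B"
    and P: "semidec (\<lambda>p. P (fst p) (snd p))" "\<And>y c. y \<in> C c \<longleftrightarrow> (\<exists>k. y \<in> B k \<and> P k c)"
    and Q: "semidec (\<lambda>p. Q (fst p) (snd p))" "\<And>y k. y \<in> B k \<longleftrightarrow> (\<exists>c. y \<in> C c \<and> Q c k)"
    and nonempty: "\<And>c. C c \<noteq> {}"
  shows "computable_topological_group G T C"
proof -
  note B_open = computable_topological_group_openin_base[OF G]
  have space: "Hausdorff_space T" "\<And>U. openin T U \<longleftrightarrow> (\<exists>S. is_name B S U)"
    "\<exists>W. ce 3 {[i, j, k] |i j k. (i, j, k) \<in> W} \<and> (\<forall>i j. B i \<inter> B j = \<Union>{B k |k. (i, j, k) \<in> W})"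
    and ops: "group G" "topspace T = carrier G"
      "effectively_continuous (prod_topology T T) (prod_base B B) T B (\<lambda>(x, y). x \<otimes>\<^bsub>G\<^esub> y)"
      "effectively_continuous T B T B (\<lambda>x. inv\<^bsub>G\<^esub> x)"
    using G unfolding computable_topological_group_def computable_topological_space_def by blast+
  obtain W where W: "semidec (\<lambda>p. (fst p, fst (snd p), snd (snd p)) \<in> W)"
    "\<And>i j. B i \<inter> B j = \<Union>{B k |k. (i, j, k) \<in> W}"
    using space(3) by (subst (asm) ce3_iff) blast
  have C_open: "openin T (C c)" for c
  proof -
    have "C c = (\<Union>k\<in>{k. P k c}. B k)" using P(2) by blast
    then show ?thesis unfolding space(2) is_name_def ..
  qed
  have "openin T U \<longleftrightarrow> (\<exists>S. is_name C S U)" for U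
  proof
    assume "openin T U"
    then obtain S where "U = (\<Union>k\<in>S. B k)" unfolding space(2) is_name_def ..
    then have "U = (\<Union>c\<in>{c. \<exists>k\<in>S. Q c k}. C c)" using Q(2) by blast
    then show "\<exists>S. is_name C S U" unfolding is_name_def ..
  next
    assume "\<exists>S. is_name C S U"
    then obtain S where "U = (\<Union>c\<in>S. C c)" unfolding is_name_def ..
    then show "openin T U" using C_open by auto
  qed
  moreover have "\<exists>W. ce 3 {[i, j, k] |i j k. (i, j, k) \<in> W} \<and>
      (\<forall>i j. C i \<inter> C j = \<Union>{C k |k. (i, j, k) \<in> W})"
  proof -
    define W' where "W' = {(i, j, c). \<exists>k l m. P k i \<and> P l j \<and> (k, l, m) \<in> W \<and> Q c m}"
    have "semidec (\<lambda>p. (fst p, fst (snd p), snd (snd p)) \<in> W')"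
      unfolding W'_def mem_Collect_eq split
      by (intro semidec_basic semidec_comp2[OF P(1)] semidec_comp2[OF Q(1)]
          semidec_comp3[where R = "\<lambda>i j k. (i, j, k) \<in> W", OF W(1)])
    then have "ce 3 {[i, j, k] |i j k. (i, j, k) \<in> W'}"
      by (subst ce3_iff)
    moreover have "C i \<inter> C j = \<Union>{C k |k. (i, j, k) \<in> W'}" for i j
    proof -
      have B_Int: "x \<in> B k \<and> x \<in> B l \<longleftrightarrow> (\<exists>m. x \<in> B m \<and> (k, l, m) \<in> W)" for x k l
        using W(2)[of k l] by blast
      have *: "x \<in> C i \<inter> C j \<longleftrightarrow> (\<exists>c. x \<in> C c \<and> (i, j, c) \<in> W')" for x
      proof -
        have "x \<in> C i \<inter> C j \<longleftrightarrow> (\<exists>k l. (x \<in> B k \<and> x \<in> B l) \<and> P k i \<and> P l j)"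
          unfolding Int_iff P(2) by blast
        also have "\<dots> \<longleftrightarrow> (\<exists>k l m. x \<in> B m \<and> (k, l, m) \<in> W \<and> P k i \<and> P l j)"
          unfolding B_Int by blast
        also have "\<dots> \<longleftrightarrow> (\<exists>c. x \<in> C c \<and> (\<exists>k l m. P k i \<and> P l j \<and> (k, l, m) \<in> W \<and> Q c m))"
          unfolding Q(2) by blast
        finally show ?thesis by (simp only: W'_def mem_Collect_eq split)
      qed
      show ?thesis
      proof (rule Set.set_eqI)
        show "x \<in> C i \<inter> C j \<longleftrightarrow> x \<in> \<Union>{C k |k. (i, j, k) \<in> W'}" for x
          unfolding *[of x] by blast
      qed
    qed
    ultimately show ?thesis by blast
  qed
  moreover have "effectively_continuous (prod_topology T T) (prod_base C C) T C (\<lambda>(x, y). x \<otimes>\<^bsub>G\<^esub> y)"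
  proof (rule effectively_continuous_change_base[OF ops(3) B_open P])
    let ?Q = "\<lambda>c k. Q (fst (prod_decode c)) (fst (prod_decode k)) \<and> Q (snd (prod_decode c)) (snd (prod_decode k))"
    show "semidec (\<lambda>p. ?Q (fst p) (snd p))"
      by (intro semidec_basic semidec_comp2[OF Q(1)])
    show "x \<in> prod_base B B k \<longleftrightarrow> (\<exists>c. x \<in> prod_base C C c \<and> ?Q c k)" for x k
    proof
      assume "x \<in> prod_base B B k"
      then obtain c c' where "fst x \<in> C c" "Q c (fst (prod_decode k))" "snd x \<in> C c'"
        "Q c' (snd (prod_decode k))"
        unfolding in_prod_base_iff Q(2) by blast
      then show "\<exists>c. x \<in> prod_base C C c \<and> ?Q c k"
        by (intro exI[of _ "prod_encode (c, c')"]) (simp add: in_prod_base_iff)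
    qed (auto simp: in_prod_base_iff Q(2))
  qed
  moreover have "effectively_continuous T C T C (\<lambda>x. inv\<^bsub>G\<^esub> x)"
    by (rule effectively_continuous_change_base[OF ops(4) B_open P Q])
  ultimately show ?thesis
    unfolding computable_topological_group_def computable_topological_space_def
    using ops(1,2) space(1) nonempty by blast
qed

section \<open>The dense sequence and its distances\<close>

context complete_computable_group
begin

lemma C_nonempty: "C c \<noteq> {}"
proof -
  have "pt (fst (prod_decode c)) \<in> C c"
    by (simp add: in_C_iff pt_carrier pos_rat_eq)
  then show ?thesis by blast
qed

lemma closure_of_pt: "mtopology closure_of range pt = carrier G"
proof -
  have "\<exists>i. d x (pt i) < r" if x: "x \<in> carrier G" and r: "0 < r" for x r
  proof -
    obtain n where "(1/2 :: real) ^ n < r" using r real_arch_pow_inv[of r "1/2"] by auto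
    moreover obtain i where "d (pt i) x < (1/2) ^ n" using pt_dense[OF x] by blast
    ultimately have "d x (pt i) < r" using commute[of x "pt i"] by linarith
    then show ?thesis ..
  qed
  then show ?thesis
    unfolding metric_closure_of using pt_carrier by auto
qed

lemma semidec_d_pt:
  "semidec (\<lambda>p. d (pt (fst p)) (pt (fst (snd p))) < of_rat (nat_to_rat_surj (snd (snd p))))"
  unfolding of_rat_nat_to_rat_surj_greater_iff[OF nonneg]
proof -
  \<comment> \<open>The conjunct \<open>0 < b\<close> is kept on both sides because
    \<open>d_less_ratio\<close> assumes a positive denominator.\<close>
  have iff: "0 < b \<and> d (pt i) (pt j) < real a / real b \<longleftrightarrow>
      0 < b \<and> (\<exists>k u v. D u v k \<and> pt i \<in> B u \<and> pt j \<in> B v \<and> ratio_less k a b)" for a b i j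
    using d_less_ratio[OF pt_carrier pt_carrier, of b i j a] D[OF pt_carrier pt_carrier, of i j]
    by (cases "0 < b") (simp, blast, simp)
  show "semidec (\<lambda>p. fst (prod_decode (snd (snd p))) - (fst (prod_decode (snd (snd p))) div 2 +
         fst (prod_decode (snd (snd p))) div 2) = snd (prod_decode (snd (snd p))) -
         (snd (prod_decode (snd (snd p))) div 2 + snd (prod_decode (snd (snd p))) div 2) \<and>
       0 < Suc (snd (prod_decode (snd (snd p)))) div 2 \<and>
       d (pt (fst p)) (pt (fst (snd p))) < real (Suc (fst (prod_decode (snd (snd p)))) div 2) /
         real (Suc (snd (prod_decode (snd (snd p)))) div 2))"
    unfolding iff
    by (intro semidec_basic D_intro pt_intro ratio_less_intro)
qed

end

section \<open>From the definitions to the locales, and the conclusion\<close>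

lemma computable_topological_group_imp_computable_group:
  assumes G: "computable_topological_group G T B"
  shows "\<exists>W M I. computable_group G B W M I"
proof -
  note B_open = computable_topological_group_openin_base[OF G]
  have space: "Hausdorff_space T" "\<And>U. openin T U \<longleftrightarrow> (\<exists>S. is_name B S U)" "\<And>i. B i \<noteq> {}"
    "\<exists>W. ce 3 {[i, j, k] |i j k. (i, j, k) \<in> W} \<and> (\<forall>i j. B i \<inter> B j = \<Union>{B k |k. (i, j, k) \<in> W})"
    and ops: "group G" "topspace T = carrier G"
      "effectively_continuous (prod_topology T T) (prod_base B B) T B (\<lambda>(x, y). x \<otimes>\<^bsub>G\<^esub> y)"
      "effectively_continuous T B T B (\<lambda>x. inv\<^bsub>G\<^esub> x)"
    using G unfolding computable_topological_group_def computable_topological_space_def by blast+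
  obtain W where W: "semidec (\<lambda>p. (fst p, fst (snd p), snd (snd p)) \<in> W)"
    "\<And>i j. B i \<inter> B j = \<Union>{B k |k. (i, j, k) \<in> W}"
    using space(4) by (subst (asm) ce3_iff) blast
  obtain M where M: "semidec (\<lambda>p. M (fst p) (snd p))"
    "\<And>x k. x \<in> topspace (prod_topology T T) \<and> (\<lambda>(x, y). x \<otimes>\<^bsub>G\<^esub> y) x \<in> B k
      \<longleftrightarrow> (\<exists>n. x \<in> prod_base B B n \<and> M n k)"
    using effectively_continuousD[OF ops(3) B_open] by blast
  obtain I where I: "semidec (\<lambda>p. I (fst p) (snd p))"
    "\<And>x k. x \<in> topspace T \<and> inv\<^bsub>G\<^esub> x \<in> B k \<longleftrightarrow> (\<exists>n. x \<in> B n \<and> I n k)"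
    using effectively_continuousD[OF ops(4) B_open] by blast
  interpret group G by (rule ops(1))
  have "computable_group G B (\<lambda>i j k. (i, j, k) \<in> W) (\<lambda>i j k. M (prod_encode (i, j)) k) I"
  proof
    show "B i \<noteq> {}" for i by (rule space(3))
    show "(\<Union>i. B i) = carrier G"
    proof
      have "B i \<subseteq> carrier G" for i using openin_subset[OF B_open] ops(2) by blast
      then show "(\<Union>i. B i) \<subseteq> carrier G" by blast
      have "openin T (carrier G)" using openin_topspace[of T] ops(2) by simp
      then obtain S where "carrier G = (\<Union>i\<in>S. B i)" unfolding space(2) is_name_def ..
      then show "carrier G \<subseteq> (\<Union>i. B i)" by blast
    qed
    show "\<exists>k. x \<in> B k \<and> y \<notin> B k" if xy: "x \<in> carrier G" "y \<in> carrier G" "x \<noteq> y" for x y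
    proof -
      obtain U V where "openin T U" "x \<in> U" "y \<in> V" "disjnt U V"
        using space(1) xy ops(2) unfolding Hausdorff_space_def by metis
      moreover from \<open>openin T U\<close> obtain S where "U = (\<Union>i\<in>S. B i)"
        unfolding space(2) is_name_def ..
      ultimately show ?thesis unfolding disjnt_def by blast
    qed
    show "semidec (\<lambda>p. (fst p, fst (snd p), snd (snd p)) \<in> W)" by (rule W(1))
    show "semidec (\<lambda>p. M (prod_encode (fst p, fst (snd p))) (snd (snd p)))"
      by (intro semidec_comp2[OF M(1)] computable_basic)
    show "semidec (\<lambda>p. I (fst p) (snd p))" by (rule I(1))
    show "x \<in> B i \<and> x \<in> B j \<longleftrightarrow> (\<exists>k. x \<in> B k \<and> (i, j, k) \<in> W)" for x i j
      using W(2)[of i j] by blast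
    show "x \<otimes>\<^bsub>G\<^esub> y \<in> B k \<longleftrightarrow> (\<exists>i j. x \<in> B i \<and> y \<in> B j \<and> M (prod_encode (i, j)) k)"
      if "x \<in> carrier G" "y \<in> carrier G" for x y k
    proof -
      have "x \<otimes>\<^bsub>G\<^esub> y \<in> B k \<longleftrightarrow> (\<exists>n. (x, y) \<in> prod_base B B n \<and> M n k)"
        using M(2)[of "(x, y)" k] that ops(2) by simp
      also have "\<dots> \<longleftrightarrow> (\<exists>i j. x \<in> B i \<and> y \<in> B j \<and> M (prod_encode (i, j)) k)"
        unfolding in_prod_base_iff fst_conv snd_conv
        by (metis fst_conv snd_conv prod_encode_inverse prod_decode_inverse prod.collapse)
      finally show ?thesis .
    qed
    show "inv\<^bsub>G\<^esub> x \<in> B k \<longleftrightarrow> (\<exists>i. x \<in> B i \<and> I i k)" if "x \<in> carrier G" for x k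
      using I(2)[of x k] that ops(2) by simp
  qed
  then show ?thesis by blast
qed

text \<open>A presentation is a group of type \<open>'a monoid\<close>, while \<open>G\<close> may
  carry further record fields.\<close>

lemma computable_topological_group_truncate:
  assumes "computable_topological_group G T B"
  shows "computable_topological_group (monoid.truncate G) T B"
proof -
  have sel: "carrier (monoid.truncate G) = carrier G" "mult (monoid.truncate G) = mult G"
    "one (monoid.truncate G) = one G"
    by (simp_all add: monoid.truncate_def)
  then have inv: "m_inv (monoid.truncate G) = m_inv G"
    by (simp add: fun_eq_iff m_inv_def)
  have "group (monoid.truncate G) = group G"
    unfolding group_def group_axioms_def monoid_def Units_def sel ..
  then show ?thesis
    using assms unfolding computable_topological_group_def sel inv by simp
qed

lemma effective_search_outcome:
  assumes "effective_search G B s"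
  shows "computable (\<lambda>n. last (s n))"
    and "search_hit G B (V_seq G B s n) (s n)"
proof -
  obtain h where h: "computable2 (\<lambda>n k. list_encode (h n k))"
    "\<And>n k. h n k \<noteq> [] \<Longrightarrow> search_hit G B (V_seq G B s n) (h n k)"
    "\<And>n. \<exists>k. h n k \<noteq> []" "\<And>n. s n = h n (LEAST k. h n k \<noteq> [])"
    using assms unfolding effective_search_def by blast
  have ne: "s n \<noteq> []" for n
    unfolding h(4) by (rule LeastI_ex[OF h(3)])
  then show hit: "search_hit G B (V_seq G B s n) (s n)" for n
    using h(2,4) by metis
  have code_0: "list_encode xs = 0 \<longleftrightarrow> xs = []" for xs
    by (cases xs) auto
  note H = computable2_imp_computable[OF h(1)]
  have "computable (\<lambda>n. LEAST k. h n k \<noteq> [])"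
  proof (rule computable_Least_decidable[OF _ h(3)])
    have "decidable (\<lambda>p. \<not> list_encode (h (fst p) (snd p)) = 0)"
      by (intro decidable_not decidable_eq H computable_basic)
    then show "decidable (\<lambda>p. h (fst p) (snd p) \<noteq> [])" by (simp only: code_0)
  qed
  then have code: "computable (\<lambda>n. list_encode (s n))"
    unfolding h(4) by (intro computable_comp2[OF H] computable_basic)
  \<comment> \<open>The code of a non-empty list is the successor of the pair of its head and the
    code of its tail. A hit has seven entries, so six tails lead to the last one.\<close>
  let ?tl = "\<lambda>c. snd (prod_decode (c - 1))"
  have "computable (\<lambda>n. fst (prod_decode (?tl (?tl (?tl (?tl (?tl (?tl (list_encode (s n))))))) - 1)))"
    by (intro computable_basic code)
  moreover have "fst (prod_decode (?tl (?tl (?tl (?tl (?tl (?tl (list_encode (s n))))))) - 1)) = last (s n)" for n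
    using hit[of n] unfolding search_hit_def by (elim exE conjE) simp
  ultimately show "computable (\<lambda>n. last (s n))" by simp
qed

theorem theorem4p1:
  fixes G :: "('a, 'm) monoid_scheme"
    and T :: "'a topology"
    and B :: "nat \<Rightarrow> 'a set"
    and s :: "nat \<Rightarrow> nat list"
    and d :: "'a \<Rightarrow> 'a \<Rightarrow> real"
  assumes "computable_topological_group G T B"
    and "effective_search G B s"
    and "d = chain_metric G (V_seq G B s)"
    and "Metric_space.mcomplete (carrier G) d"
  shows "has_right_ce_Polish_presentation G T"
proof -
  obtain W M I where "computable_group G B W M I"
    using computable_topological_group_imp_computable_group[OF assms(1)] by blast
  then interpret computable_group_search G B W M I s
    by (intro computable_group_search.intro computable_group_search_axioms.intro
        effective_search_outcome[OF assms(2)])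
  interpret complete_computable_group G B W M I s
    by unfold_locales (use assms(3,4) in simp)
  let ?H = "monoid.truncate G"
  have carrier: "carrier ?H = carrier G"
    by (simp add: monoid.truncate_def)
  \<comment> \<open>The open sets of either topology are exactly the unions of sets
    \<open>B i\<close>.\<close>
  have T: "T = mtopology"
    unfolding topology_eq openin_mtopology_iff
    using assms(1) unfolding computable_topological_group_def computable_topological_space_def is_name_def
    by blast
  have "computable_topological_group ?H T C"
    by (rule computable_topological_group_change_base[OF computable_topological_group_truncate[OF assms(1)]
          semidec_ball_name ball_name semidec_B_name B_name C_nonempty])
  moreover have "ce 3 {[i, j, q] |i j q. d (pt i) (pt j) < of_rat (nat_to_rat_surj q)}"
    unfolding assms(3) by (subst ce3_iff) (rule semidec_d_pt)
  ultimately have "right_ce_Polish_group ?H T d pt"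
    unfolding right_ce_Polish_group_def carrier assms(3)
    using Metric_space_axioms complete T closure_of_pt pt_carrier by auto
  moreover have "id \<in> iso G ?H"
    by (auto simp: iso_def hom_def monoid.truncate_def bij_betw_def)
  ultimately show ?thesis
    unfolding has_right_ce_Polish_presentation_def using homeomorphic_map_id by blast
qed

end
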